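(* Let $V_1,V_2$ be two commuting smooth real vector fields on $\mathbb{R}^4$ (coordinates $(t,x^1,x^2,x^3)$) with $[V_a,\mathfrak{e}_3]\subseteq\mathfrak{e}_3$ for $a=1,2$, where $\mathfrak{e}_3=\mathrm{span}(p_i,L_i)$, $p_i=\partial_i$, $L_i=\epsilon_{ijk}x^j\partial_k$. Then, up to replacing $(V_1,V_2)$ by another pair leading to the same twist $\mathcal{F}_V$, the pair is of one of the following six types, where $c_a^i,d_1^i,f_a,\kappa$ are real constants, $\mathbf{d}_1=(d_1^1,d_1^2,d_1^3)$, and $V_1^0,V_2^0\in C^\infty(\mathbb{R})$ satisfy $[V_1^0(t)\partial_t,V_2^0(t)\partial_t]=0$: - $\mathfrak{C}_{11}$: $V_1=V_1^0(t)\partial_t+c_1^i\partial_i$, $V_2=V_2^0(t)\partial_t+c_2^i\partial_i$; - $\mathfrak{C}_{21}$ ($f_1\ne0$): $V_1=c_1^i\partial_i+f_1x^i\partial_i$, $V_2=V_2^0(t)\partial_t$; - $\mathfrak{C}_{31}$ ($f_2\neq0$): $V_1=V_1^0(t)\partial_t$, $V_2=c_2^i\partial_i+f_2x^i\partial_i$ (equivalent to $\mathfrak{C}_{21}$ by interchanging the labels of the vector fields); - $\mathfrak{C}_{12}$ ($\mathbf{d}_1\neq0$): $V_1=V_1^0(t)\partial_t+c_1^i\partial_i+d_1^iL_i$, $V_2=V_2^0(t)\partial_t+\kappa\,d_1^i\partial_i$; - $\mathfrak{C}_{22}$ ($\mathbf{d}_1\neq0$, $f_1\neq0$): $V_1=c_1^i\partial_i+d_1^iL_i+f_1x^i\partial_i$,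 $V_2=V_2^0(t)\partial_t$; - $\mathfrak{C}_{32}$ ($\mathbf{d}_1\neq0$, $f_2\neq0$): $V_1=V_1^0(t)\partial_t+\frac{1}{f_2}d_1^jc_2^k\epsilon_{jki}\partial_i+d_1^iL_i$, $V_2=V_2^0(t)\partial_t+c_2^i\partial_i+f_2x^i\partial_i$. Conversely, each of the listed pairs commutes and satisfies $[V_a,\mathfrak{e}_3]\subseteq\mathfrak{e}_3$. The condition $[V_1^0\partial_t,V_2^0\partial_t]=0$ is solved by taking one of $V_1^0,V_2^0$ zero and the other arbitrary. If both are nonzero and real-analytic, it gives the global relation $V_2^0=\kappa'V_1^0$ with some constant $\kappa'\in\mathbb{R}$. For smooth non-analytic functions it gives only local conditions, restricting the functions to be linearly dependent in the overlap of their supports; in particular, functions with disjoint supports fulfill it trivially.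
   Context: Repeated spatial indices are summed over $1,2,3$; $\epsilon_{ijk}$ is the Levi-Civita symbol; $\partial_i=\partial/\partial x^i$; $[\cdot,\cdot]$ is the Lie bracket of vector fields. For two commuting vector fields $V_1,V_2$ the associated twist is the element $\mathcal{F}_V=\exp\bigl(-\frac{i\lambda}{2}(V_1\otimes V_2-V_2\otimes V_1)\bigr)\in U\Xi\otimes U\Xi$, a formal power series in $\lambda$, where $U\Xi$ is the universal enveloping algebra of the Lie algebra $\Xi$ of vector fields on $\mathbb{R}^4$. Two pairs lead to the same twist if they give the same element $\mathcal{F}_V$; for example, the map $V_2\to V_2-\kappa V_1$ with constant $\kappa\in\mathbb{R}$ conserves the twist.
   Formalization: False as stated, e.g. f∂_t+x^i∂_i, g∂_t with disjoint bumps f,g. Proved: six types if the time components are linearly dependent; else six types or C21/C22 with an extra V_1^0∂_t, proved never twist-equivalent to them. Supports are nonvanishing sets; dependence is on each interval of the overlap. *)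

theory Defs
  imports "HOL-Analysis.Analysis" "HOL-Library.Poly_Mapping"
begin

section \<open>Smooth maps\<close>

primrec Ck :: "nat \<Rightarrow> ('a::real_normed_vector \<Rightarrow> 'b::real_normed_vector) \<Rightarrow> bool" where
  "Ck 0 f \<longleftrightarrow> continuous_on UNIV f"
| "Ck (Suc k) f \<longleftrightarrow>
     (\<forall>x. f differentiable (at x)) \<and> (\<forall>v. Ck k (\<lambda>x. frechet_derivative f (at x) v))"

definition smooth :: "('a::real_normed_vector \<Rightarrow> 'b::real_normed_vector) \<Rightarrow> bool" where
  "smooth f \<longleftrightarrow> (\<forall>k. Ck k f)"

text \<open>The library predicate \<open>analytic_on\<close>, read over the reals, only expresses differentiability;
  real-analyticity is therefore stated through local power series expansions.\<close>

definition real_analytic :: "(real \<Rightarrow> real) \<Rightarrow> bool" where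
  "real_analytic f \<longleftrightarrow> (\<forall>t. \<exists>F. (\<lambda>h. f (t + h)) has_fps_expansion F)"

definition lin_dep_on :: "'a set \<Rightarrow> ('a \<Rightarrow> real) \<Rightarrow> ('a \<Rightarrow> real) \<Rightarrow> bool" where
  "lin_dep_on S f g \<longleftrightarrow> (\<exists>a b. (a \<noteq> 0 \<or> b \<noteq> 0) \<and> (\<forall>x\<in>S. a * f x + b * g x = 0))"

lemma smooth_const: "smooth (\<lambda>_. c)"
proof -
  have "Ck k (\<lambda>_::'a. c::'b)" for k and c
    by (induction k arbitrary: c) auto
  then show ?thesis by (simp add: smooth_def)
qed

lemma Ck_Suc_imp: "Ck (Suc k) f \<Longrightarrow> Ck k f"
proof (induction k arbitrary: f)
  case 0
  then have "\<forall>x. f differentiable (at x)" by simp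
  then show ?case
    by (simp add: continuous_on_eq_continuous_at differentiable_imp_continuous_within)
next
  case (Suc k)
  then show ?case by (metis Ck.simps(2))
qed

lemma Ck_add: "Ck k f \<Longrightarrow> Ck k g \<Longrightarrow> Ck k (\<lambda>x. f x + g x)"
proof (induction k arbitrary: f g)
  case 0
  then show ?case by (auto intro: continuous_intros)
next
  case (Suc k)
  have f: "(f has_derivative frechet_derivative f (at x)) (at x)"
    and g: "(g has_derivative frechet_derivative g (at x)) (at x)" for x
    using Suc.prems by (simp_all add: frechet_derivative_works)
  have D: "((\<lambda>x. f x + g x) has_derivative
      (\<lambda>v. frechet_derivative f (at x) v + frechet_derivative g (at x) v)) (at x)" for x
    by (rule has_derivative_add[OF f g])
  have "frechet_derivative (\<lambda>x. f x + g x) (at x)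
      = (\<lambda>v. frechet_derivative f (at x) v + frechet_derivative g (at x) v)" for x
    using frechet_derivative_at[OF D] by simp
  then show ?case using Suc differentiableI[OF D] by auto
qed

lemma Ck_bilinear:
  assumes "bounded_bilinear prd"
  shows "Ck k f \<Longrightarrow> Ck k g \<Longrightarrow> Ck k (\<lambda>x. prd (f x) (g x))"
proof (induction k arbitrary: f g)
  case 0
  then show ?case using bounded_bilinear.continuous_on[OF assms] by auto
next
  case (Suc k)
  have f: "(f has_derivative frechet_derivative f (at x)) (at x)"
    and g: "(g has_derivative frechet_derivative g (at x)) (at x)" for x
    using Suc.prems by (simp_all add: frechet_derivative_works)
  have D: "((\<lambda>x. prd (f x) (g x)) has_derivative
      (\<lambda>v. prd (f x) (frechet_derivative g (at x) v) + prd (frechet_derivative f (at x) v) (g x))) (at x)" for x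
    by (rule bounded_bilinear.FDERIV[OF assms f g])
  have eq: "frechet_derivative (\<lambda>x. prd (f x) (g x)) (at x)
      = (\<lambda>v. prd (f x) (frechet_derivative g (at x) v) + prd (frechet_derivative f (at x) v) (g x))" for x
    using frechet_derivative_at[OF D] by simp
  have "Ck k f" "Ck k g" using Suc.prems Ck_Suc_imp by blast+
  then show ?case using Suc differentiableI[OF D] by (auto simp: eq intro!: Ck_add)
qed

lemma Ck_linear_left:
  assumes h: "bounded_linear h"
  shows "Ck k f \<Longrightarrow> Ck k (\<lambda>x. h (f x))"
proof (induction k arbitrary: f)
  case 0
  then show ?case using linear_continuous_on_compose bounded_linear.continuous_on[OF h] by auto
next
  case (Suc k)
  have f: "(f has_derivative frechet_derivative f (at x)) (at x)" for x
    using Suc.prems by (simp add: frechet_derivative_works)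
  have D: "((\<lambda>x. h (f x)) has_derivative (\<lambda>v. h (frechet_derivative f (at x) v))) (at x)" for x
    by (rule bounded_linear.has_derivative[OF h f])
  have "frechet_derivative (\<lambda>x. h (f x)) (at x) = (\<lambda>v. h (frechet_derivative f (at x) v))" for x
    using frechet_derivative_at[OF D] by simp
  then show ?case using Suc differentiableI[OF D] by auto
qed

lemma Ck_linear_right:
  assumes h: "bounded_linear h"
  shows "Ck k f \<Longrightarrow> Ck k (\<lambda>x. f (h x))"
proof (induction k arbitrary: f)
  case 0
  have "continuous_on UNIV h" using h by (simp add: linear_continuous_on)
  with 0 show ?case using continuous_on_compose2[of UNIV f UNIV h] by auto
next
  case (Suc k)
  have f: "(f has_derivative frechet_derivative f (at x)) (at x)" for x
    using Suc.prems by (simp add: frechet_derivative_works)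
  have hd: "(h has_derivative h) (at x)" for x
    using bounded_linear_imp_has_derivative[OF h] .
  have D: "((\<lambda>x. f (h x)) has_derivative (\<lambda>v. frechet_derivative f (at (h x)) (h v))) (at x)" for x
    by (rule has_derivative_compose[OF hd f])
  have eq: "frechet_derivative (\<lambda>x. f (h x)) (at x) = (\<lambda>v. frechet_derivative f (at (h x)) (h v))" for x
    using frechet_derivative_at[OF D] by simp
  have "Ck k (\<lambda>x. frechet_derivative f (at (h x)) (h v))" for v
    using Suc.IH[of "\<lambda>y. frechet_derivative f (at y) (h v)"] Suc.prems by simp
  then show ?case using differentiableI[OF D] by (auto simp: eq)
qed

lemma smooth_add: "smooth f \<Longrightarrow> smooth g \<Longrightarrow> smooth (\<lambda>x. f x + g x)"
  by (simp add: smooth_def Ck_add)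

lemma smooth_scaleR: "smooth f \<Longrightarrow> smooth g \<Longrightarrow> smooth (\<lambda>x. f x *\<^sub>R g x)"
  by (simp add: smooth_def Ck_bilinear[OF bounded_bilinear_scaleR])

lemma smooth_linear_left: "bounded_linear h \<Longrightarrow> smooth f \<Longrightarrow> smooth (\<lambda>x. h (f x))"
  by (simp add: smooth_def Ck_linear_left)

lemma smooth_linear_right: "bounded_linear h \<Longrightarrow> smooth f \<Longrightarrow> smooth (\<lambda>x. f (h x))"
  by (simp add: smooth_def Ck_linear_right)

lemma smooth_id: "smooth (\<lambda>x :: 'a::real_normed_vector. x)"
proof -
  have "Ck k (\<lambda>x :: 'a. x)" for k
    by (cases k) (use smooth_const in \<open>auto simp: smooth_def\<close>)
  then show ?thesis by (simp add: smooth_def)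
qed

lemma smooth_linear: "bounded_linear h \<Longrightarrow> smooth h"
  using smooth_linear_left[OF _ smooth_id] .

lemma smooth_scaleR_const: "smooth f \<Longrightarrow> smooth (\<lambda>x. r *\<^sub>R f x)"
  using smooth_linear_left[OF bounded_linear_scaleR_right] .

lemma smooth_sum: "(\<And>i. i \<in> I \<Longrightarrow> smooth (f i)) \<Longrightarrow> smooth (\<lambda>x. \<Sum>i\<in>I. f i x)"
  by (induction I rule: infinite_finite_induct) (auto intro: smooth_add smooth_const)

lemma smooth_directional_derivative:
  fixes X :: "'a::euclidean_space \<Rightarrow> 'a" and Y :: "'a \<Rightarrow> 'b::real_normed_vector"
  assumes X: "smooth X" and Y: "smooth Y"
  shows "smooth (\<lambda>p. frechet_derivative Y (at p) (X p))"
proof -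
  have "Ck (Suc 0) Y" using Y by (simp only: smooth_def)
  then have "Y differentiable (at p)" for p by simp
  then have lin: "linear (frechet_derivative Y (at p))" for p
    by (rule linear_frechet_derivative)
  have eq: "(\<lambda>p. frechet_derivative Y (at p) (X p))
      = (\<lambda>p. \<Sum>b\<in>Basis. (X p \<bullet> b) *\<^sub>R frechet_derivative Y (at p) b)" (is "_ = ?S")
  proof
    fix p
    have "frechet_derivative Y (at p) (X p)
        = frechet_derivative Y (at p) (\<Sum>b\<in>Basis. (X p \<bullet> b) *\<^sub>R b)"
      by (simp add: euclidean_representation)
    also have "\<dots> = ?S p"
      by (simp add: linear_sum[OF lin] linear_cmul[OF lin])
    finally show "frechet_derivative Y (at p) (X p) = ?S p" .
  qed
  have "smooth (\<lambda>p. frechet_derivative Y (at p) b)" for b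
    unfolding smooth_def
  proof
    fix k
    have "Ck (Suc k) Y" using Y by (simp only: smooth_def)
    then show "Ck k (\<lambda>p. frechet_derivative Y (at p) b)" by simp
  qed
  moreover have "smooth (\<lambda>p. X p \<bullet> b)" for b
    by (rule smooth_linear_left[OF bounded_linear_inner_left X])
  ultimately have "smooth (\<lambda>p. (X p \<bullet> b) *\<^sub>R frechet_derivative Y (at p) b)" for b
    by (intro smooth_scaleR)
  then show ?thesis unfolding eq by (intro smooth_sum)
qed

section \<open>The Lie algebra of vector fields on four-dimensional space-time\<close>

text \<open>A point of $\mathbb{R}^4$ is a pair \<open>(t, x)\<close>; a vector field is given by its components with
  respect to the coordinate fields.\<close>

type_synonym spacetime = "real \<times> (real ^ 3)"

typedef vfield = "{X :: spacetime \<Rightarrow> spacetime. smooth X}"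
  morphisms vf_at Vfield
  using smooth_const by blast

setup_lifting type_definition_vfield

instantiation vfield :: real_vector
begin
lift_definition zero_vfield :: vfield is "\<lambda>_. 0" by (rule smooth_const)
lift_definition plus_vfield :: "vfield \<Rightarrow> vfield \<Rightarrow> vfield" is "\<lambda>X Y p. X p + Y p"
  by (rule smooth_add)
lift_definition scaleR_vfield :: "real \<Rightarrow> vfield \<Rightarrow> vfield" is "\<lambda>r X p. r *\<^sub>R X p"
  by (rule smooth_scaleR_const)
lift_definition uminus_vfield :: "vfield \<Rightarrow> vfield" is "\<lambda>X p. - X p"
  using smooth_scaleR_const[of _ "-1"] by simp
lift_definition minus_vfield :: "vfield \<Rightarrow> vfield \<Rightarrow> vfield" is "\<lambda>X Y p. X p - Y p"
  using smooth_add smooth_scaleR_const[of _ "-1"] by fastforce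
instance
  by standard (transfer; auto simp: algebra_simps)+
end

text \<open>$[X,Y]^\nu = X^\mu\partial_\mu Y^\nu - Y^\mu\partial_\mu X^\nu$\<close>

lift_definition bracket :: "vfield \<Rightarrow> vfield \<Rightarrow> vfield" is
  "\<lambda>X Y p. frechet_derivative Y (at p) (X p) - frechet_derivative X (at p) (Y p)"
proof -
  fix X Y :: "spacetime \<Rightarrow> spacetime"
  assume "smooth X" "smooth Y"
  then have "smooth (\<lambda>p. frechet_derivative Y (at p) (X p))"
    and "smooth (\<lambda>p. (-1) *\<^sub>R frechet_derivative X (at p) (Y p))"
    by (simp_all only: smooth_scaleR_const smooth_directional_derivative)
  from smooth_add[OF this]
  show "smooth (\<lambda>p. frechet_derivative Y (at p) (X p) - frechet_derivative X (at p) (Y p))"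
    by simp
qed

definition levi_civita :: "3 \<Rightarrow> 3 \<Rightarrow> 3 \<Rightarrow> real" where
  "levi_civita i j k =
     (if (i, j, k) \<in> {(1, 2, 3), (2, 3, 1), (3, 1, 2)} then 1
      else if (i, j, k) \<in> {(1, 3, 2), (3, 2, 1), (2, 1, 3)} then - 1
      else 0)"

lift_definition p_field :: "3 \<Rightarrow> vfield" is "\<lambda>i (t, x). (0, axis i 1)"
  by (simp add: case_prod_beta' smooth_const)

lift_definition L_field :: "3 \<Rightarrow> vfield" is
  "\<lambda>i (t, x). (0, \<Sum>j\<in>UNIV. \<Sum>k\<in>UNIV. (levi_civita i j k * x $ j) *\<^sub>R axis k 1)"
proof -
  fix i
  let ?h = "\<lambda>q :: spacetime. (0 :: real,
      \<Sum>j\<in>UNIV. \<Sum>k\<in>UNIV. (levi_civita i j k * snd q $ j) *\<^sub>R (axis k 1 :: real ^ 3))"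
  have "linear ?h"
    by (rule linearI)
      (simp_all add: scaleR_sum_right algebra_simps sum.distrib)
  then have "bounded_linear ?h" by (simp add: linear_conv_bounded_linear)
  then show "smooth (\<lambda>(t :: real, x). (0 :: real,
      \<Sum>j\<in>UNIV. \<Sum>k\<in>UNIV. (levi_civita i j k * x $ j) *\<^sub>R (axis k 1 :: real ^ 3)))"
    by (simp add: case_prod_beta' smooth_linear)
qed

text \<open>The dilation field $x^i\partial_i$\<close>

lift_definition x_field :: vfield is "\<lambda>(t, x). (0, x)"
proof -
  have "bounded_linear (\<lambda>q :: spacetime. (0 :: real, snd q))"
    by (intro bounded_linear_Pair bounded_linear_zero bounded_linear_snd)
  then show "smooth (\<lambda>(t :: real, x :: real ^ 3). (0 :: real, x))"
    by (simp add: case_prod_beta' smooth_linear)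
qed

text \<open>\<open>time_field f\<close> is $f(t)\,\partial_t$; meaningful only for smooth \<open>f\<close>.\<close>

definition time_field :: "(real \<Rightarrow> real) \<Rightarrow> vfield" where
  "time_field f = Vfield (\<lambda>(t, x). (f t, 0))"

lemma vf_at_time_field:
  assumes "smooth f"
  shows "vf_at (time_field f) = (\<lambda>(t, x). (f t, 0))"
proof -
  have "smooth (\<lambda>q :: spacetime. f (fst q))"
    by (rule smooth_linear_right[OF bounded_linear_fst assms])
  moreover have "bounded_linear (\<lambda>r :: real. (r, 0 :: real ^ 3))"
    by (intro bounded_linear_Pair bounded_linear_zero bounded_linear_ident)
  ultimately have "smooth (\<lambda>q :: spacetime. (f (fst q), 0 :: real ^ 3))"
    using smooth_linear_left by blast
  then show ?thesis
    by (simp add: time_field_def Vfield_inverse case_prod_beta')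
qed

definition time_comp :: "vfield \<Rightarrow> spacetime \<Rightarrow> real" where
  "time_comp V q = fst (vf_at V q)"

definition trans_field :: "real ^ 3 \<Rightarrow> vfield" where
  "trans_field c = (\<Sum>i\<in>UNIV. (c $ i) *\<^sub>R p_field i)"

definition rot_field :: "real ^ 3 \<Rightarrow> vfield" where
  "rot_field d = (\<Sum>i\<in>UNIV. (d $ i) *\<^sub>R L_field i)"

definition e3 :: "vfield set" where
  "e3 = span (range p_field \<union> range L_field)"

definition preserves_e3 :: "vfield \<Rightarrow> bool" where
  "preserves_e3 V \<longleftrightarrow> (\<forall>X\<in>e3. bracket V X \<in> e3)"

lifting_forget vfield.lifting

section \<open>The universal enveloping algebra and its tensor square\<close>

definition two_sided_ideal :: "'a::ring set \<Rightarrow> bool" where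
  "two_sided_ideal J \<longleftrightarrow> 0 \<in> J \<and> (\<forall>x\<in>J. \<forall>y\<in>J. x - y \<in> J) \<and> (\<forall>x\<in>J. \<forall>r. r * x \<in> J \<and> x * r \<in> J)"

definition ideal_gen :: "'a::ring set \<Rightarrow> 'a set" where
  "ideal_gen S = \<Inter>{J. two_sided_ideal J \<and> S \<subseteq> J}"

lemma two_sided_ideal_ideal_gen: "two_sided_ideal (ideal_gen S)"
  unfolding two_sided_ideal_def ideal_gen_def by blast

lemma ideal_gen_incl: "x \<in> S \<Longrightarrow> x \<in> ideal_gen S"
  unfolding ideal_gen_def by blast

lemma ideal_gen_zero: "0 \<in> ideal_gen S"
  and ideal_gen_diff: "x \<in> ideal_gen S \<Longrightarrow> y \<in> ideal_gen S \<Longrightarrow> x - y \<in> ideal_gen S"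
  and ideal_gen_left: "x \<in> ideal_gen S \<Longrightarrow> r * x \<in> ideal_gen S"
  and ideal_gen_right: "x \<in> ideal_gen S \<Longrightarrow> x * r \<in> ideal_gen S"
  using two_sided_ideal_ideal_gen[of S] unfolding two_sided_ideal_def by blast+

lemma ideal_gen_uminus: "x \<in> ideal_gen S \<Longrightarrow> - x \<in> ideal_gen S"
  using ideal_gen_diff[OF ideal_gen_zero] by fastforce

lemma ideal_gen_add: "x \<in> ideal_gen S \<Longrightarrow> y \<in> ideal_gen S \<Longrightarrow> x + y \<in> ideal_gen S"
  using ideal_gen_diff[OF _ ideal_gen_uminus] by fastforce

lemma equivp_ideal_gen: "equivp (\<lambda>x y. x - y \<in> ideal_gen S)"
proof (rule equivpI)
  show "reflp (\<lambda>x y. x - y \<in> ideal_gen S)" by (simp add: reflp_def ideal_gen_zero)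
  show "symp (\<lambda>x y. x - y \<in> ideal_gen S)"
    by (rule sympI) (use ideal_gen_uminus in fastforce)
  show "transp (\<lambda>x y. x - y \<in> ideal_gen S)"
    by (rule transpI) (use ideal_gen_add in fastforce)
qed

lemma ideal_gen_cong_add:
  assumes "x - x' \<in> ideal_gen S" "y - y' \<in> ideal_gen S"
  shows "(x + y) - (x' + y') \<in> ideal_gen S"
  using ideal_gen_add[OF assms] by (simp add: algebra_simps)

lemma ideal_gen_cong_diff:
  assumes "x - x' \<in> ideal_gen S" "y - y' \<in> ideal_gen S"
  shows "(x - y) - (x' - y') \<in> ideal_gen S"
  using ideal_gen_diff[OF assms] by (simp add: algebra_simps)

lemma ideal_gen_cong_uminus:
  assumes "x - x' \<in> ideal_gen S"
  shows "(- x) - (- x') \<in> ideal_gen S"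
  using ideal_gen_uminus[OF assms] by (simp add: algebra_simps)

lemma ideal_gen_cong_times:
  assumes "x - x' \<in> ideal_gen S" "y - y' \<in> ideal_gen S"
  shows "x * y - x' * y' \<in> ideal_gen S"
  using ideal_gen_add[OF ideal_gen_right[OF assms(1), of y] ideal_gen_left[OF assms(2), of x']]
  by (simp add: algebra_simps)

text \<open>Finitely supported functions \<open>'m \<Rightarrow>\<^sub>0 complex\<close> on an additively written monoid, with the
  convolution product of \<open>Poly_Mapping\<close>, form the complex monoid algebra. For the monoid of words
  this is the free (tensor) algebra.\<close>

datatype 'a word = Word "'a list"

instantiation word :: (type) monoid_add
begin
definition zero_word :: "'a word" where "0 = Word []"
fun plus_word :: "'a word \<Rightarrow> 'a word \<Rightarrow> 'a word" where "Word u + Word v = Word (u @ v)"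
instance
proof
  fix a b c :: "'a word"
  show "a + b + c = a + (b + c)" by (cases a; cases b; cases c) simp
  show "0 + a = a" "a + 0 = a" by (cases a; simp add: zero_word_def)+
qed
end

abbreviation gen_word :: "'a \<Rightarrow> 'a word \<Rightarrow>\<^sub>0 complex" where
  "gen_word X \<equiv> Poly_Mapping.single (Word [X]) 1"

text \<open>\<open>uea\<close> is the complex enveloping algebra $U\Xi$: the free complex algebra on the real vector
  fields modulo real linearity and $XY - YX = [X,Y]$.\<close>

definition uea_relations :: "(vfield word \<Rightarrow>\<^sub>0 complex) set" where
  "uea_relations =
     {gen_word (X + Y) - gen_word X - gen_word Y | X Y. True} \<union>
     {gen_word (r *\<^sub>R X) - Poly_Mapping.single (Word [X]) (complex_of_real r) | r X. True} \<union>
     {gen_word X * gen_word Y - gen_word Y * gen_word X - gen_word (bracket X Y) | X Y. True}"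

quotient_type uea = "vfield word \<Rightarrow>\<^sub>0 complex" / "\<lambda>a b. a - b \<in> ideal_gen uea_relations"
  by (rule equivp_ideal_gen)

instantiation uea :: "{ring, monoid_mult}"
begin
lift_definition zero_uea :: uea is 0 .
lift_definition one_uea :: uea is 1 .
lift_definition plus_uea :: "uea \<Rightarrow> uea \<Rightarrow> uea" is "(+)" by (rule ideal_gen_cong_add)
lift_definition minus_uea :: "uea \<Rightarrow> uea \<Rightarrow> uea" is "(-)" by (rule ideal_gen_cong_diff)
lift_definition uminus_uea :: "uea \<Rightarrow> uea" is uminus by (rule ideal_gen_cong_uminus)
lift_definition times_uea :: "uea \<Rightarrow> uea \<Rightarrow> uea" is "(*)" by (rule ideal_gen_cong_times)
instance
  by standard (transfer; simp add: algebra_simps ideal_gen_zero)+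
end

lift_definition uea_scale :: "complex \<Rightarrow> uea \<Rightarrow> uea" is "\<lambda>z a. Poly_Mapping.single 0 z * a"
  by (rule ideal_gen_cong_times) (simp_all add: ideal_gen_zero)

lift_definition uea_gen :: "vfield \<Rightarrow> uea" is gen_word .

lemma uea_gen_add: "uea_gen (X + Y) = uea_gen X + uea_gen Y"
proof transfer
  fix X Y :: vfield
  have "gen_word (X + Y) - gen_word X - gen_word Y \<in> uea_relations"
    unfolding uea_relations_def by blast
  then show "gen_word (X + Y) - (gen_word X + gen_word Y) \<in> ideal_gen uea_relations"
    by (simp add: ideal_gen_incl diff_diff_eq)
qed

lemma uea_gen_scaleR: "uea_gen (r *\<^sub>R X) = uea_scale (complex_of_real r) (uea_gen X)"
proof transfer
  fix r and X :: vfield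
  have "gen_word (r *\<^sub>R X) - Poly_Mapping.single (Word [X]) (complex_of_real r) \<in> uea_relations"
    unfolding uea_relations_def by blast
  then show "gen_word (r *\<^sub>R X) - Poly_Mapping.single 0 (complex_of_real r) * gen_word X
      \<in> ideal_gen uea_relations"
    by (simp add: ideal_gen_incl mult_single)
qed

lifting_forget uea.lifting

text \<open>\<open>uea2\<close> is $U\Xi\otimes_{\mathbb{C}} U\Xi$: the free vector space on pairs, modulo bilinearity.
  \<open>mkey\<close> writes a multiplicative monoid additively, so that convolution becomes
  $(a\otimes b)(a'\otimes b') = aa'\otimes bb'$; the span of the bilinearity relations is then itself
  a two-sided ideal.\<close>

datatype 'a mkey = MKey 'a

instantiation mkey :: (monoid_mult) monoid_add
begin
definition zero_mkey :: "'a mkey" where "0 = MKey 1"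
fun plus_mkey :: "'a mkey \<Rightarrow> 'a mkey \<Rightarrow> 'a mkey" where "MKey a + MKey b = MKey (a * b)"
instance
proof
  fix a b c :: "'a mkey"
  show "a + b + c = a + (b + c)" by (cases a; cases b; cases c) (simp add: mult.assoc)
  show "0 + a = a" "a + 0 = a" by (cases a; simp add: zero_mkey_def)+
qed
end

abbreviation scaled_pair :: "complex \<Rightarrow> uea \<Rightarrow> uea \<Rightarrow> (uea mkey \<times> uea mkey) \<Rightarrow>\<^sub>0 complex" where
  "scaled_pair z a b \<equiv> Poly_Mapping.single (MKey a, MKey b) z"

definition uea2_relations :: "((uea mkey \<times> uea mkey) \<Rightarrow>\<^sub>0 complex) set" where
  "uea2_relations =
     {scaled_pair 1 (a + a') b - scaled_pair 1 a b - scaled_pair 1 a' b | a a' b. True} \<union>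
     {scaled_pair 1 a (b + b') - scaled_pair 1 a b - scaled_pair 1 a b' | a b b'. True} \<union>
     {scaled_pair 1 (uea_scale z a) b - scaled_pair z a b | z a b. True} \<union>
     {scaled_pair 1 a (uea_scale z b) - scaled_pair z a b | z a b. True}"

quotient_type uea2 = "(uea mkey \<times> uea mkey) \<Rightarrow>\<^sub>0 complex" /
    "\<lambda>a b. a - b \<in> ideal_gen uea2_relations"
  by (rule equivp_ideal_gen)

instantiation uea2 :: "{ring, monoid_mult}"
begin
lift_definition zero_uea2 :: uea2 is 0 .
lift_definition one_uea2 :: uea2 is 1 .
lift_definition plus_uea2 :: "uea2 \<Rightarrow> uea2 \<Rightarrow> uea2" is "(+)" by (rule ideal_gen_cong_add)
lift_definition minus_uea2 :: "uea2 \<Rightarrow> uea2 \<Rightarrow> uea2" is "(-)" by (rule ideal_gen_cong_diff)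
lift_definition uminus_uea2 :: "uea2 \<Rightarrow> uea2" is uminus by (rule ideal_gen_cong_uminus)
lift_definition times_uea2 :: "uea2 \<Rightarrow> uea2 \<Rightarrow> uea2" is "(*)" by (rule ideal_gen_cong_times)
instance
  by standard (transfer; simp add: algebra_simps ideal_gen_zero)+
end

lift_definition uea2_scale :: "complex \<Rightarrow> uea2 \<Rightarrow> uea2" is "\<lambda>z a. Poly_Mapping.single 0 z * a"
  by (rule ideal_gen_cong_times) (simp_all add: ideal_gen_zero)

lift_definition tensor :: "uea \<Rightarrow> uea \<Rightarrow> uea2" (infixl \<open>\<otimes>\<close> 72) is "scaled_pair 1" .

lemma tensor_add_left: "(a + a') \<otimes> b = a \<otimes> b + a' \<otimes> b"
proof transfer
  fix a a' b :: uea
  have "scaled_pair 1 (a + a') b - scaled_pair 1 a b - scaled_pair 1 a' b \<in> uea2_relations"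
    unfolding uea2_relations_def by blast
  then show "scaled_pair 1 (a + a') b - (scaled_pair 1 a b + scaled_pair 1 a' b)
      \<in> ideal_gen uea2_relations"
    by (simp add: ideal_gen_incl diff_diff_eq)
qed

lemma tensor_add_right: "a \<otimes> (b + b') = a \<otimes> b + a \<otimes> b'"
proof transfer
  fix a b b' :: uea
  have "scaled_pair 1 a (b + b') - scaled_pair 1 a b - scaled_pair 1 a b' \<in> uea2_relations"
    unfolding uea2_relations_def by blast
  then show "scaled_pair 1 a (b + b') - (scaled_pair 1 a b + scaled_pair 1 a b')
      \<in> ideal_gen uea2_relations"
    by (simp add: ideal_gen_incl diff_diff_eq)
qed

lemma tensor_scale_left: "uea_scale z a \<otimes> b = uea2_scale z (a \<otimes> b)"
proof transfer
  fix z and a b :: uea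
  have "scaled_pair 1 (uea_scale z a) b - scaled_pair z a b \<in> uea2_relations"
    unfolding uea2_relations_def by blast
  then show "scaled_pair 1 (uea_scale z a) b - Poly_Mapping.single 0 z * scaled_pair 1 a b
      \<in> ideal_gen uea2_relations"
    by (simp add: ideal_gen_incl mult_single)
qed

lemma tensor_scale_right: "a \<otimes> uea_scale z b = uea2_scale z (a \<otimes> b)"
proof transfer
  fix z and a b :: uea
  have "scaled_pair 1 a (uea_scale z b) - scaled_pair z a b \<in> uea2_relations"
    unfolding uea2_relations_def by blast
  then show "scaled_pair 1 a (uea_scale z b) - Poly_Mapping.single 0 z * scaled_pair 1 a b
      \<in> ideal_gen uea2_relations"
    by (simp add: ideal_gen_incl mult_single)
qed

lifting_forget uea2.lifting

section \<open>The twist\<close>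

definition fps_exp_lambda :: "uea2 \<Rightarrow> uea2 fps" where
  "fps_exp_lambda h = Abs_fps (\<lambda>n. uea2_scale (1 / fact n) (h ^ n))"

text \<open>$\mathcal{F}_V = \exp(\lambda h)$ with $h = -\frac{i}{2}(V_1\otimes V_2 - V_2\otimes V_1)$,
  the formal variable of \<open>fps\<close> being $\lambda$.\<close>

definition twist :: "vfield \<Rightarrow> vfield \<Rightarrow> uea2 fps" where
  "twist V1 V2 = fps_exp_lambda
     (uea2_scale (- \<i> / 2) (uea_gen V1 \<otimes> uea_gen V2 - uea_gen V2 \<otimes> uea_gen V1))"

lemma twist_shear: "twist V1 (V2 - \<kappa> *\<^sub>R V1) = twist V1 V2"
proof -
  have "V2 - \<kappa> *\<^sub>R V1 = V2 + (- \<kappa>) *\<^sub>R V1" by simp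
  then show ?thesis
    by (simp only: twist_def uea_gen_add uea_gen_scaleR tensor_add_left tensor_add_right
        tensor_scale_left tensor_scale_right)
      (simp add: algebra_simps)
qed

section \<open>The types of pairs\<close>

definition time_commute :: "(real \<Rightarrow> real) \<Rightarrow> (real \<Rightarrow> real) \<Rightarrow> bool" where
  "time_commute f g \<longleftrightarrow> bracket (time_field f) (time_field g) = 0"

definition type_C11 :: "vfield \<Rightarrow> vfield \<Rightarrow> bool" where
  "type_C11 V1 V2 \<longleftrightarrow> (\<exists>f g c1 c2. smooth f \<and> smooth g \<and> time_commute f g \<and>
     V1 = time_field f + trans_field c1 \<and>
     V2 = time_field g + trans_field c2)"

definition type_C21 :: "vfield \<Rightarrow> vfield \<Rightarrow> bool" where
  "type_C21 V1 V2 \<longleftrightarrow> (\<exists>g c1 f1. smooth g \<and> f1 \<noteq> 0 \<and>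
     V1 = trans_field c1 + f1 *\<^sub>R x_field \<and>
     V2 = time_field g)"

definition type_C31 :: "vfield \<Rightarrow> vfield \<Rightarrow> bool" where
  "type_C31 V1 V2 \<longleftrightarrow> (\<exists>f c2 f2. smooth f \<and> f2 \<noteq> 0 \<and>
     V1 = time_field f \<and>
     V2 = trans_field c2 + f2 *\<^sub>R x_field)"

definition type_C12 :: "vfield \<Rightarrow> vfield \<Rightarrow> bool" where
  "type_C12 V1 V2 \<longleftrightarrow> (\<exists>f g c1 d1 \<kappa>. smooth f \<and> smooth g \<and> time_commute f g \<and> d1 \<noteq> 0 \<and>
     V1 = time_field f + trans_field c1 + rot_field d1 \<and>
     V2 = time_field g + \<kappa> *\<^sub>R trans_field d1)"

definition type_C22 :: "vfield \<Rightarrow> vfield \<Rightarrow> bool" where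
  "type_C22 V1 V2 \<longleftrightarrow> (\<exists>g c1 d1 f1. smooth g \<and> d1 \<noteq> 0 \<and> f1 \<noteq> 0 \<and>
     V1 = trans_field c1 + rot_field d1 + f1 *\<^sub>R x_field \<and>
     V2 = time_field g)"

definition type_C32 :: "vfield \<Rightarrow> vfield \<Rightarrow> bool" where
  "type_C32 V1 V2 \<longleftrightarrow> (\<exists>f g d1 c2 f2. smooth f \<and> smooth g \<and> time_commute f g \<and> d1 \<noteq> 0 \<and> f2 \<noteq> 0 \<and>
     V1 = time_field f
        + (1 / f2) *\<^sub>R (\<Sum>i\<in>UNIV. (\<Sum>j\<in>UNIV. \<Sum>k\<in>UNIV. d1 $ j * c2 $ k * levi_civita j k i) *\<^sub>R p_field i)
        + rot_field d1 \<and>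
     V2 = time_field g + trans_field c2 + f2 *\<^sub>R x_field)"

definition listed :: "vfield \<Rightarrow> vfield \<Rightarrow> bool" where
  "listed V1 V2 \<longleftrightarrow> type_C11 V1 V2 \<or> type_C21 V1 V2 \<or> type_C31 V1 V2 \<or>
     type_C12 V1 V2 \<or> type_C22 V1 V2 \<or> type_C32 V1 V2"

text \<open>Since $[V_1^0\partial_t,V_2^0\partial_t]=0$ does not force smooth $V_1^0,V_2^0$ to be globally
  proportional, commuting pairs such as $V_1 = f\partial_t + x^i\partial_i$, $V_2 = g\partial_t$
  with bump functions $f,g$ of disjoint support exist: the twist determines the real plane spanned by
  $V_1,V_2$, and no field in this plane with a nonzero dilation part has vanishing time component, so
  no pair of the six types has the same twist (\<open>residual_not_listed\<close>). These pairs, of type C21 or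
  C22 except for an additional $V_1^0(t)\partial_t$ in $V_1$, form a class of their own.\<close>

definition residual :: "vfield \<Rightarrow> vfield \<Rightarrow> bool" where
  "residual V1 V2 \<longleftrightarrow> (\<exists>f g c1 d1 f1. smooth f \<and> smooth g \<and> time_commute f g \<and>
     \<not> lin_dep_on UNIV f g \<and> f1 \<noteq> 0 \<and>
     V1 = time_field f + trans_field c1 + rot_field d1 + f1 *\<^sub>R x_field \<and>
     V2 = time_field g)"

section \<open>Residual pairs have no listed pair with the same twist\<close>

text \<open>Vector fields act on smooth functions, $U\Xi$ therefore does, and evaluating at points recovers
  the bivector $V_1\otimes V_2 - V_2\otimes V_1$ from the twist.\<close>

lemma second_difference:
  fixes f :: "'a::real_normed_vector \<Rightarrow> real"
  assumes f: "\<And>x. f differentiable (at x)" and fu: "\<And>x. (\<lambda>q. frechet_derivative f (at q) u) differentiable (at x)"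
    and s: "0 < s"
  shows "\<exists>\<xi> \<eta>. 0 < \<xi> \<and> \<xi> < s \<and> 0 < \<eta> \<and> \<eta> < s \<and>
    f (p + s *\<^sub>R u + s *\<^sub>R v) - f (p + s *\<^sub>R u) - f (p + s *\<^sub>R v) + f p
      = s * s * frechet_derivative (\<lambda>q. frechet_derivative f (at q) u) (at (p + \<xi> *\<^sub>R u + \<eta> *\<^sub>R v)) v"
proof -
  have dl: "((\<lambda>t. h (a + t *\<^sub>R w)) has_real_derivative frechet_derivative h (at (a + t *\<^sub>R w)) w) (at t)"
    if h: "\<And>x. h differentiable (at x)" for h :: "'a \<Rightarrow> real" and a w t
  proof -
    have 1: "((\<lambda>t. a + t *\<^sub>R w) has_derivative (\<lambda>t. t *\<^sub>R w)) (at t)"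
      by (auto intro!: derivative_eq_intros)
    have 2: "(h has_derivative frechet_derivative h (at (a + t *\<^sub>R w))) (at (a + t *\<^sub>R w))"
      using h frechet_derivative_works by blast
    have "((\<lambda>t. h (a + t *\<^sub>R w)) has_derivative (\<lambda>r. frechet_derivative h (at (a + t *\<^sub>R w)) (r *\<^sub>R w))) (at t)"
      by (rule has_derivative_compose[OF 1 2])
    moreover have "linear (frechet_derivative h (at (a + t *\<^sub>R w)))" using h by (rule linear_frechet_derivative)
    ultimately show ?thesis
      by (simp add: has_field_derivative_def linear_cmul mult_commute_abs)
  qed
  let ?fu = "\<lambda>q. frechet_derivative f (at q) u"
  let ?g = "\<lambda>t. f ((p + s *\<^sub>R v) + t *\<^sub>R u) - f (p + t *\<^sub>R u)"
  have g: "(?g has_real_derivative ?fu ((p + s *\<^sub>R v) + t *\<^sub>R u) - ?fu (p + t *\<^sub>R u)) (at t)" for t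
    by (rule DERIV_diff[OF dl[OF f] dl[OF f]])
  obtain \<xi> where x: "0 < \<xi>" "\<xi> < s" "?g s - ?g 0 = (s - 0) * (?fu ((p + s *\<^sub>R v) + \<xi> *\<^sub>R u) - ?fu (p + \<xi> *\<^sub>R u))"
    using MVT2[OF s, of ?g, OF g] by blast
  let ?k = "\<lambda>t. ?fu ((p + \<xi> *\<^sub>R u) + t *\<^sub>R v)"
  obtain \<eta> where y: "0 < \<eta>" "\<eta> < s" "?k s - ?k 0 = (s - 0) * frechet_derivative ?fu (at ((p + \<xi> *\<^sub>R u) + \<eta> *\<^sub>R v)) v"
    using MVT2[OF s, of ?k, OF dl[OF fu]] by blast
  have "?fu ((p + s *\<^sub>R v) + \<xi> *\<^sub>R u) = ?k s" by (simp add: algebra_simps)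
  then have "?g s - ?g 0 = s * (s * frechet_derivative ?fu (at ((p + \<xi> *\<^sub>R u) + \<eta> *\<^sub>R v)) v)"
    using x(3) y(3) by simp
  moreover have "?g s - ?g 0 = f (p + s *\<^sub>R u + s *\<^sub>R v) - f (p + s *\<^sub>R u) - f (p + s *\<^sub>R v) + f p"
    by (simp add: algebra_simps)
  ultimately show ?thesis using x(1,2) y(1,2) by (metis mult.assoc)
qed

lemma second_derivative_symmetric_real:
  fixes f :: "'a::real_normed_vector \<Rightarrow> real"
  assumes sm: "smooth f"
  shows "frechet_derivative (\<lambda>q. frechet_derivative f (at q) u) (at p) v
       = frechet_derivative (\<lambda>q. frechet_derivative f (at q) v) (at p) u"
proof -
  have "Ck (Suc (Suc 0)) f" using sm unfolding smooth_def by (rule spec)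
  then have d1: "\<forall>x. f differentiable (at x)" and C: "\<forall>w. Ck (Suc 0) (\<lambda>q. frechet_derivative f (at q) w)"
    unfolding Ck.simps(2)[of "Suc 0"] by (rule conjunct1, rule conjunct2)
  note C' = C[THEN spec, unfolded Ck.simps]
  have d: "f differentiable (at x)" "(\<lambda>q. frechet_derivative f (at q) w) differentiable (at x)" for w x
    by (rule d1[THEN spec], rule C'[THEN conjunct1, THEN spec])
  have c: "continuous_on UNIV (\<lambda>x. frechet_derivative (\<lambda>q. frechet_derivative f (at q) w) (at x) z)" for w z
    by (rule C'[THEN conjunct2, THEN spec])
  define H where "H w z x = frechet_derivative (\<lambda>q. frechet_derivative f (at q) w) (at x) z" for w z x
  have ex: "\<exists>a b c e. norm a \<le> 1 \<and> norm b \<le> 1 \<and> norm c \<le> 1 \<and> norm e \<le> (1::real) \<and>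
     H u v (p + s *\<^sub>R (a *\<^sub>R u + b *\<^sub>R v)) = H v u (p + s *\<^sub>R (c *\<^sub>R v + e *\<^sub>R u))" if s: "0 < s" for s
  proof -
    have "\<exists>\<xi> \<eta>. 0 < \<xi> \<and> \<xi> < s \<and> 0 < \<eta> \<and> \<eta> < s \<and>
      f (p + s *\<^sub>R u + s *\<^sub>R v) - f (p + s *\<^sub>R u) - f (p + s *\<^sub>R v) + f p = s * s * H u v (p + \<xi> *\<^sub>R u + \<eta> *\<^sub>R v)"
      unfolding H_def by (rule second_difference[OF d(1) d(2) s])
    then obtain \<xi> \<eta> where 1: "0 < \<xi>" "\<xi> < s" "0 < \<eta>" "\<eta> < s"
      "f (p + s *\<^sub>R u + s *\<^sub>R v) - f (p + s *\<^sub>R u) - f (p + s *\<^sub>R v) + f p = s * s * H u v (p + \<xi> *\<^sub>R u + \<eta> *\<^sub>R v)"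
      by (elim exE conjE)
    have "\<exists>\<xi> \<eta>. 0 < \<xi> \<and> \<xi> < s \<and> 0 < \<eta> \<and> \<eta> < s \<and>
      f (p + s *\<^sub>R v + s *\<^sub>R u) - f (p + s *\<^sub>R v) - f (p + s *\<^sub>R u) + f p = s * s * H v u (p + \<xi> *\<^sub>R v + \<eta> *\<^sub>R u)"
      unfolding H_def by (rule second_difference[OF d(1) d(2) s])
    then obtain \<xi>' \<eta>' where 2: "0 < \<xi>'" "\<xi>' < s" "0 < \<eta>'" "\<eta>' < s"
      "f (p + s *\<^sub>R v + s *\<^sub>R u) - f (p + s *\<^sub>R v) - f (p + s *\<^sub>R u) + f p = s * s * H v u (p + \<xi>' *\<^sub>R v + \<eta>' *\<^sub>R u)"
      by (elim exE conjE)
    have "f (p + s *\<^sub>R v + s *\<^sub>R u) = f (p + s *\<^sub>R u + s *\<^sub>R v)" by (simp add: algebra_simps)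
    then have "s * s * H u v (p + \<xi> *\<^sub>R u + \<eta> *\<^sub>R v) = s * s * H v u (p + \<xi>' *\<^sub>R v + \<eta>' *\<^sub>R u)"
      using 1(5) 2(5) by linarith
    then have "H u v (p + \<xi> *\<^sub>R u + \<eta> *\<^sub>R v) = H v u (p + \<xi>' *\<^sub>R v + \<eta>' *\<^sub>R u)" using s by simp
    then have "H u v (p + s *\<^sub>R ((\<xi>/s) *\<^sub>R u + (\<eta>/s) *\<^sub>R v)) = H v u (p + s *\<^sub>R ((\<xi>'/s) *\<^sub>R v + (\<eta>'/s) *\<^sub>R u))"
      using s by (simp add: scaleR_add_right add.assoc)
    moreover have "norm (\<xi>/s) \<le> 1" "norm (\<eta>/s) \<le> 1" "norm (\<xi>'/s) \<le> 1" "norm (\<eta>'/s) \<le> 1"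
      using 1 2 s by (simp_all add: divide_le_eq_1)
    ultimately show ?thesis by blast
  qed
  define sn where "sn n = inverse (real (Suc n))" for n
  have sn: "sn \<longlonglongrightarrow> 0" "0 < sn n" for n unfolding sn_def by (rule LIMSEQ_inverse_real_of_nat) simp
  have "\<forall>n. \<exists>a b c e. norm a \<le> 1 \<and> norm b \<le> 1 \<and> norm c \<le> 1 \<and> norm e \<le> (1::real) \<and>
     H u v (p + sn n *\<^sub>R (a *\<^sub>R u + b *\<^sub>R v)) = H v u (p + sn n *\<^sub>R (c *\<^sub>R v + e *\<^sub>R u))" using ex sn(2) by blast
  then obtain a b c e where abce: "\<And>n. norm (a n) \<le> 1" "\<And>n. norm (b n) \<le> 1" "\<And>n. norm (c n) \<le> 1" "\<And>n. norm (e n) \<le> (1::real)"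
     "\<And>n. H u v (p + sn n *\<^sub>R (a n *\<^sub>R u + b n *\<^sub>R v)) = H v u (p + sn n *\<^sub>R (c n *\<^sub>R v + e n *\<^sub>R u))" by metis
  have z: "(\<lambda>n. p + sn n *\<^sub>R (x n *\<^sub>R w + y n *\<^sub>R w')) \<longlonglongrightarrow> p"
    if "\<And>n. norm (x n) \<le> 1" "\<And>n. norm (y n) \<le> (1::real)" for x y and w w' :: 'a
  proof -
    have "norm (x n *\<^sub>R w + y n *\<^sub>R w') \<le> norm w + norm w'" for n
    proof -
      have "norm (x n *\<^sub>R w + y n *\<^sub>R w') \<le> norm (x n *\<^sub>R w) + norm (y n *\<^sub>R w')" by (rule norm_triangle_ineq)
      also have "\<dots> \<le> norm w + norm w'" using that[of n] by (auto intro!: add_mono mult_left_le_one_le)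
      finally show ?thesis .
    qed
    then have "Bfun (\<lambda>n. x n *\<^sub>R w + y n *\<^sub>R w') sequentially" by (intro BfunI always_eventually) auto
    then have "(\<lambda>n. sn n *\<^sub>R (x n *\<^sub>R w + y n *\<^sub>R w')) \<longlonglongrightarrow> 0"
      using sn(1) bounded_bilinear.Zfun_prod_Bfun[OF bounded_bilinear_scaleR] by (simp add: tendsto_Zfun_iff)
    from tendsto_add[OF tendsto_const this] show ?thesis by simp
  qed
  have cont: "isCont (H w y) p" for w y
    using c[of w y] by (simp add: H_def[abs_def] continuous_on_eq_continuous_at)
  have "(\<lambda>n. H u v (p + sn n *\<^sub>R (a n *\<^sub>R u + b n *\<^sub>R v))) \<longlonglongrightarrow> H u v p"
    by (rule isCont_tendsto_compose[OF cont z]) (use abce in auto)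
  moreover have "(\<lambda>n. H v u (p + sn n *\<^sub>R (c n *\<^sub>R v + e n *\<^sub>R u))) \<longlonglongrightarrow> H v u p"
    by (rule isCont_tendsto_compose[OF cont z]) (use abce in auto)
  ultimately have "H u v p = H v u p" using abce(5) LIMSEQ_unique by simp
  then show ?thesis by (simp add: H_def)
qed

lemma vf_at_add: "vf_at (X + Y) p = vf_at X p + vf_at Y p"
  by (simp add: plus_vfield.rep_eq)
lemma vf_at_scaleR: "vf_at (r *\<^sub>R X) p = r *\<^sub>R vf_at X p"
  by (simp add: scaleR_vfield.rep_eq)

lemma vf_at_trans: "vf_at (trans_field c) (t, x) = (0, c)"
  by (simp add: trans_field_def sum_3 vf_at_add vf_at_scaleR p_field.rep_eq vec_eq_iff forall_3 axis_def)

lemma vf_at_rot: "vf_at (rot_field d) (t, x) = (0, cross3 d x)"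
  by (simp add: rot_field_def sum_3 vf_at_add vf_at_scaleR L_field.rep_eq vec_eq_iff forall_3 axis_def
      levi_civita_def cross3_simps)

lemma vf_at_x: "vf_at x_field (t, x) = (0, x)"
  by (simp add: x_field.rep_eq)

definition vf_der :: "vfield \<Rightarrow> (spacetime \<Rightarrow> complex) \<Rightarrow> spacetime \<Rightarrow> complex" where
  "vf_der X \<phi> p = frechet_derivative \<phi> (at p) (vf_at X p)"

primrec list_act :: "vfield list \<Rightarrow> (spacetime \<Rightarrow> complex) \<Rightarrow> spacetime \<Rightarrow> complex" where
  "list_act [] \<phi> = \<phi>" | "list_act (X # w) \<phi> = vf_der X (list_act w \<phi>)"

primrec word_act where "word_act (Word w) \<phi> = list_act w \<phi>"

lemma smooth_vf: "smooth (vf_at X)" using vf_at by auto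

lemma smooth_D: "smooth \<phi> \<Longrightarrow> (\<phi> has_derivative frechet_derivative \<phi> (at p)) (at p)"
proof -
  assume "smooth \<phi>"
  then have "Ck (Suc 0) \<phi>" by (simp only: smooth_def)
  then show ?thesis by (simp add: frechet_derivative_works)
qed

lemma smooth_D': "smooth f \<Longrightarrow> (f has_derivative frechet_derivative f (at p)) (at p)"
proof -
  assume "smooth f"
  then have "Ck (Suc 0) f" by (simp only: smooth_def)
  then show ?thesis by (simp add: frechet_derivative_works)
qed

lemma smooth_diff: "smooth f \<Longrightarrow> f differentiable (at p)"
  using smooth_D' frechet_derivative_works by blast

lemma smooth_dd: "smooth f \<Longrightarrow> smooth (\<lambda>p. frechet_derivative f (at p) v)"
  unfolding smooth_def
proof
  fix k assume "\<forall>k. Ck k f" then have "Ck (Suc k) f" by blast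
  then show "Ck k (\<lambda>p. frechet_derivative f (at p) v)" by simp
qed

lemma smooth_der: "smooth \<phi> \<Longrightarrow> smooth (vf_der X \<phi>)"
  unfolding vf_der_def by (rule smooth_directional_derivative[OF smooth_vf])

lemma smooth_actl: "smooth \<phi> \<Longrightarrow> smooth (list_act w \<phi>)"
  by (induction w) (auto intro: smooth_der)

lemma smooth_actw: "smooth \<phi> \<Longrightarrow> smooth (word_act w \<phi>)"
  by (cases w) (auto intro: smooth_actl)

lemma smooth_cmul: "smooth \<phi> \<Longrightarrow> smooth (\<lambda>p. (c::complex) * \<phi> p)"
  using smooth_linear_left[OF bounded_linear_mult_right] .

lemma der_add: "smooth \<phi> \<Longrightarrow> smooth \<psi> \<Longrightarrow> vf_der X (\<lambda>p. \<phi> p + \<psi> p) = (\<lambda>p. vf_der X \<phi> p + vf_der X \<psi> p)"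
proof
  fix p assume a: "smooth \<phi>" "smooth \<psi>"
  have "frechet_derivative (\<lambda>p. \<phi> p + \<psi> p) (at p) = (\<lambda>v. frechet_derivative \<phi> (at p) v + frechet_derivative \<psi> (at p) v)"
    using frechet_derivative_at[OF has_derivative_add[OF smooth_D[OF a(1)] smooth_D[OF a(2)]]] by simp
  then show "vf_der X (\<lambda>p. \<phi> p + \<psi> p) p = vf_der X \<phi> p + vf_der X \<psi> p" by (simp add: vf_der_def)
qed

lemma der_cmul: "smooth \<phi> \<Longrightarrow> vf_der X (\<lambda>p. c * \<phi> p) = (\<lambda>p. c * vf_der X \<phi> p)"
proof
  fix p assume a: "smooth \<phi>"
  have "frechet_derivative (\<lambda>p. c * \<phi> p) (at p) = (\<lambda>v. c * frechet_derivative \<phi> (at p) v)"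
    using frechet_derivative_at[OF bounded_linear.has_derivative[OF bounded_linear_mult_right smooth_D[OF a]]] by simp
  then show "vf_der X (\<lambda>p. c * \<phi> p) p = c * vf_der X \<phi> p" by (simp add: vf_der_def)
qed

lemma actl_add: "smooth \<phi> \<Longrightarrow> smooth \<psi> \<Longrightarrow> list_act w (\<lambda>p. \<phi> p + \<psi> p) = (\<lambda>p. list_act w \<phi> p + list_act w \<psi> p)"
  by (induction w) (auto simp: der_add smooth_actl)

lemma actl_cmul: "smooth \<phi> \<Longrightarrow> list_act w (\<lambda>p. c * \<phi> p) = (\<lambda>p. c * list_act w \<phi> p)"
  by (induction w) (auto simp: der_cmul smooth_actl)

lemma actl_app: "list_act (u @ v) \<phi> = list_act u (list_act v \<phi>)"
  by (induction u) auto

lemma actw_add: "smooth \<phi> \<Longrightarrow> smooth \<psi> \<Longrightarrow> word_act w (\<lambda>p. \<phi> p + \<psi> p) = (\<lambda>p. word_act w \<phi> p + word_act w \<psi> p)"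
  by (cases w) (simp add: actl_add)

lemma actw_cmul: "smooth \<phi> \<Longrightarrow> word_act w (\<lambda>p. c * \<phi> p) = (\<lambda>p. c * word_act w \<phi> p)"
  by (cases w) (simp add: actl_cmul)

lemma actw_app: "word_act (u + v) \<phi> = word_act u (word_act v \<phi>)"
  by (cases u; cases v) (simp add: actl_app)

lemma actw_sum: "finite I \<Longrightarrow> (\<And>i. i \<in> I \<Longrightarrow> smooth (\<phi> i)) \<Longrightarrow>
  word_act w (\<lambda>p. \<Sum>i\<in>I. c i * \<phi> i p) = (\<lambda>p. \<Sum>i\<in>I. c i * word_act w (\<phi> i) p)"
proof (induction I rule: finite_induct)
  case empty
  have "word_act w (\<lambda>p. 0 * 0) = (\<lambda>p. 0 * word_act w (\<lambda>_. 0) p)" using actw_cmul[of "\<lambda>_. 0" w 0, OF smooth_const] by simp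
  then show ?case by simp
next
  case (insert i I)
  have "smooth (\<lambda>p. \<Sum>i\<in>I. c i * \<phi> i p)" using insert by (intro smooth_sum smooth_cmul) auto
  then show ?case using insert by (simp add: actw_add actw_cmul smooth_cmul)
qed

definition linear_ext :: "('a \<Rightarrow> complex) \<Rightarrow> ('a \<Rightarrow>\<^sub>0 complex) \<Rightarrow> complex" where
  "linear_ext F a = (\<Sum>w\<in>Poly_Mapping.keys a. Poly_Mapping.lookup a w * F w)"

lemma lext_sup: "finite K \<Longrightarrow> Poly_Mapping.keys a \<subseteq> K \<Longrightarrow> linear_ext F a = (\<Sum>w\<in>K. Poly_Mapping.lookup a w * F w)"
  unfolding linear_ext_def by (rule sum.mono_neutral_left) (auto simp: in_keys_iff)

lemma lext_add: "linear_ext F (a + b) = linear_ext F a + linear_ext F b"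
proof -
  let ?K = "Poly_Mapping.keys a \<union> Poly_Mapping.keys b"
  have "linear_ext F (a+b) = (\<Sum>w\<in>?K. Poly_Mapping.lookup (a+b) w * F w)"
    by (rule lext_sup) (auto dest: Poly_Mapping.keys_add[THEN subsetD])
  moreover have "linear_ext F a = (\<Sum>w\<in>?K. Poly_Mapping.lookup a w * F w)" by (rule lext_sup) auto
  moreover have "linear_ext F b = (\<Sum>w\<in>?K. Poly_Mapping.lookup b w * F w)" by (rule lext_sup) auto
  ultimately show ?thesis by (simp add: lookup_add sum.distrib algebra_simps)
qed

lemma lext_zero[simp]: "linear_ext F 0 = 0" by (simp add: linear_ext_def)

lemma lext_uminus: "linear_ext F (- a) = - linear_ext F a"
proof -
  have "linear_ext F (- a) + linear_ext F a = 0" using lext_add[of F "-a" a] by simp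
  then show ?thesis by (simp add: eq_neg_iff_add_eq_0)
qed

lemma lext_minus: "linear_ext F (a - b) = linear_ext F a - linear_ext F b"
  using lext_add[of F a "-b"] by (simp add: lext_uminus)

lemma lext_single[simp]: "linear_ext F (Poly_Mapping.single w c) = c * F w"
  by (simp add: linear_ext_def)

lemma poly_mapping_induct [case_names single sum]:
  fixes P :: "('a \<Rightarrow>\<^sub>0 complex) \<Rightarrow> bool"
  assumes s: "\<And>k v. P (Poly_Mapping.single k v)" and a: "\<And>p q. P p \<Longrightarrow> P q \<Longrightarrow> P (p + q)"
  shows "P x"
proof (induction x rule: update_induct)
  case const
  show ?case using s[of undefined 0] by simp
next
  case (update f k v)
  have "Poly_Mapping.update k v f = f + Poly_Mapping.single k v"
    by (rule poly_mapping_eqI) (use update in \<open>auto simp: lookup_update lookup_add lookup_single in_keys_iff when_def\<close>)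
  then show ?case using update s a by simp
qed

lemma lext_single_mult: "linear_ext F (Poly_Mapping.single u c * b) = c * linear_ext (\<lambda>v. F (u + v)) b"
proof (induction b rule: poly_mapping_induct)
  case (single k v) then show ?case by (simp add: mult_single)
next
  case (sum p q) then show ?case by (simp add: lext_add distrib_left)
qed

lemma lext_mult_single: "linear_ext F (b * Poly_Mapping.single u c) = c * linear_ext (\<lambda>v. F (v + u)) b"
proof (induction b rule: poly_mapping_induct)
  case (single k v) then show ?case by (simp add: mult_single)
next
  case (sum p q) then show ?case by (simp add: lext_add distrib_left distrib_right)
qed

lemma ideal_in: "two_sided_ideal J \<Longrightarrow> S \<subseteq> J \<Longrightarrow> ideal_gen S \<subseteq> J"
  unfolding ideal_gen_def by blast

lemma two_sided_ideal_monoid_alg: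
  fixes J :: "('m::monoid_add \<Rightarrow>\<^sub>0 complex) set"
  assumes "0 \<in> J" "\<And>x y. x \<in> J \<Longrightarrow> y \<in> J \<Longrightarrow> x - y \<in> J"
    "\<And>x u c. x \<in> J \<Longrightarrow> Poly_Mapping.single u c * x \<in> J"
    "\<And>x u c. x \<in> J \<Longrightarrow> x * Poly_Mapping.single u c \<in> J"
  shows "two_sided_ideal J"
proof -
  have neg: "x \<in> J \<Longrightarrow> - x \<in> J" for x using assms(2)[OF assms(1), of x] by simp
  have add: "x \<in> J \<Longrightarrow> y \<in> J \<Longrightarrow> x + y \<in> J" for x y using assms(2)[OF _ neg, of x y] by simp
  have "x \<in> J \<Longrightarrow> r * x \<in> J" for x r
    by (induction r rule: poly_mapping_induct) (auto simp: assms distrib_right add)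
  moreover have "x \<in> J \<Longrightarrow> x * r \<in> J" for x r
    by (induction r rule: poly_mapping_induct) (auto simp: assms distrib_left add)
  ultimately show ?thesis using assms unfolding two_sided_ideal_def by blast
qed

definition uea_act :: "(vfield word \<Rightarrow>\<^sub>0 complex) \<Rightarrow> (spacetime \<Rightarrow> complex) \<Rightarrow> spacetime \<Rightarrow> complex" where
  "uea_act a \<phi> p = linear_ext (\<lambda>w. word_act w \<phi> p) a"

lemma fd_lin:
  assumes "bounded_linear h" "smooth \<phi>"
  shows "frechet_derivative (\<lambda>q. h (\<phi> q)) (at p) v = h (frechet_derivative \<phi> (at p) v)"
  by (rule fun_cong[OF frechet_derivative_at[OF bounded_linear.has_derivative[OF assms(1) smooth_D'[OF assms(2)]]], symmetric])

lemma second_derivative_symmetric: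
  fixes \<phi> :: "spacetime \<Rightarrow> complex"
  assumes s: "smooth \<phi>"
  shows "frechet_derivative (\<lambda>q. frechet_derivative \<phi> (at q) u) (at p) v
       = frechet_derivative (\<lambda>q. frechet_derivative \<phi> (at q) v) (at p) u"
proof -
  have h: "h (frechet_derivative (\<lambda>q. frechet_derivative \<phi> (at q) u) (at p) v)
       = h (frechet_derivative (\<lambda>q. frechet_derivative \<phi> (at q) v) (at p) u)" if "bounded_linear h" for h :: "complex \<Rightarrow> real"
  proof -
    have s2: "smooth (\<lambda>q. frechet_derivative \<phi> (at q) u)" for u using s by (rule smooth_dd)
    show ?thesis
      using second_derivative_symmetric_real[OF smooth_linear_left[OF that s], of u p v]
      unfolding fd_lin[OF that s] fd_lin[OF that s2] .
  qed
  show ?thesis by (rule complex_eqI) (rule h[OF bounded_linear_Re], rule h[OF bounded_linear_Im])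
qed

lemma der_der:
  assumes s: "smooth \<phi>"
  shows "vf_der X (vf_der Y \<phi>) p = frechet_derivative \<phi> (at p) (frechet_derivative (vf_at Y) (at p) (vf_at X p))
     + frechet_derivative (\<lambda>q. frechet_derivative \<phi> (at q) (vf_at X p)) (at p) (vf_at Y p)"
proof -
  let ?D = "frechet_derivative \<phi> (at p)" and ?DY = "frechet_derivative (vf_at Y) (at p)"
  have uea_linear: "linear (frechet_derivative \<phi> (at q))" for q
    by (rule linear_frechet_derivative) (rule smooth_diff[OF s])
  have exp: "L w = (\<Sum>b\<in>Basis. (w \<bullet> b) *\<^sub>R L b)" if "linear L" for L :: "spacetime \<Rightarrow> complex" and w
    using linear_sum[OF that, of "\<lambda>b. (w \<bullet> b) *\<^sub>R b" Basis]
    by (simp add: euclidean_representation linear_cmul[OF that])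
  have e: "vf_der Y \<phi> = (\<lambda>q. \<Sum>b\<in>Basis. (vf_at Y q \<bullet> b) *\<^sub>R frechet_derivative \<phi> (at q) b)"
    unfolding vf_der_def by (rule ext) (rule exp[OF uea_linear])
  have Y: "((\<lambda>q. vf_at Y q \<bullet> b) has_derivative (\<lambda>v. ?DY v \<bullet> b)) (at p)" for b
    by (rule bounded_linear.has_derivative[OF bounded_linear_inner_left smooth_D'[OF smooth_vf]])
  have P: "((\<lambda>q. frechet_derivative \<phi> (at q) b) has_derivative frechet_derivative (\<lambda>q. frechet_derivative \<phi> (at q) b) (at p)) (at p)" for b
    by (rule smooth_D'[OF smooth_dd[OF s]])
  have "((\<lambda>q. \<Sum>b\<in>Basis. (vf_at Y q \<bullet> b) *\<^sub>R frechet_derivative \<phi> (at q) b) has_derivative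
     (\<lambda>v. \<Sum>b\<in>Basis. (vf_at Y p \<bullet> b) *\<^sub>R frechet_derivative (\<lambda>q. frechet_derivative \<phi> (at q) b) (at p) v + (?DY v \<bullet> b) *\<^sub>R ?D b)) (at p)"
    by (rule has_derivative_sum) (rule has_derivative_scaleR[OF Y P])
  note D = fun_cong[OF frechet_derivative_at[OF this], of "vf_at X p", symmetric]
  have "vf_der X (vf_der Y \<phi>) p = (\<Sum>b\<in>Basis. (vf_at Y p \<bullet> b) *\<^sub>R frechet_derivative (\<lambda>q. frechet_derivative \<phi> (at q) b) (at p) (vf_at X p))
      + (\<Sum>b\<in>Basis. (?DY (vf_at X p) \<bullet> b) *\<^sub>R ?D b)"
    unfolding vf_der_def[of X] e D by (rule sum.distrib)
  also have "(\<Sum>b\<in>Basis. (?DY (vf_at X p) \<bullet> b) *\<^sub>R ?D b) = ?D (?DY (vf_at X p))" by (rule exp[OF uea_linear, symmetric])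
  also have "(\<Sum>b\<in>Basis. (vf_at Y p \<bullet> b) *\<^sub>R frechet_derivative (\<lambda>q. frechet_derivative \<phi> (at q) b) (at p) (vf_at X p))
     = (\<Sum>b\<in>Basis. (vf_at Y p \<bullet> b) *\<^sub>R frechet_derivative (\<lambda>q. frechet_derivative \<phi> (at q) (vf_at X p)) (at p) b)"
    by (intro sum.cong refl arg_cong2[where f = scaleR] second_derivative_symmetric[OF s])
  also have "\<dots> = frechet_derivative (\<lambda>q. frechet_derivative \<phi> (at q) (vf_at X p)) (at p) (vf_at Y p)"
    by (rule exp[symmetric]) (rule linear_frechet_derivative[OF smooth_diff[OF smooth_dd[OF s]]])
  finally show ?thesis by (rule trans[OF _ add.commute])
qed

lemma der_comm:
  assumes s: "smooth \<phi>"
  shows "vf_der X (vf_der Y \<phi>) p - vf_der Y (vf_der X \<phi>) p = vf_der (bracket X Y) \<phi> p"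
proof -
  have "linear (frechet_derivative \<phi> (at p))" by (rule linear_frechet_derivative) (rule smooth_diff[OF s])
  note l = linear_diff[OF this]
  have "vf_der (bracket X Y) \<phi> p = frechet_derivative \<phi> (at p) (frechet_derivative (vf_at Y) (at p) (vf_at X p))
     - frechet_derivative \<phi> (at p) (frechet_derivative (vf_at X) (at p) (vf_at Y p))"
    unfolding vf_der_def bracket.rep_eq l ..
  then show ?thesis
    using der_der[OF s, of X Y p] der_der[OF s, of Y X p] second_derivative_symmetric[OF s, of "vf_at Y p" p "vf_at X p"] 
    by (simp only: add_diff_cancel_right)
qed

lemma der_lin: "smooth \<phi> \<Longrightarrow> linear (frechet_derivative \<phi> (at p))"
  by (rule linear_frechet_derivative) (rule smooth_diff)

lemma rel_act: "a \<in> uea_relations \<Longrightarrow> smooth \<phi> \<Longrightarrow> uea_act a \<phi> p = 0"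
  unfolding uea_relations_def uea_act_def
  using der_lin[of \<phi> p] der_comm[of \<phi> _ _ p]
  by (auto simp: lext_minus mult_single)
    (auto simp: vf_der_def vf_at_add vf_at_scaleR linear_add linear_cmul scaleR_conv_of_real)

lemma act_single_mult: "uea_act (Poly_Mapping.single u c * a) \<phi> p = c * word_act u (uea_act a \<phi>) p" if "smooth \<phi>"
proof -
  have "word_act u (uea_act a \<phi>) = word_act u (\<lambda>p. \<Sum>w\<in>Poly_Mapping.keys a. Poly_Mapping.lookup a w * word_act w \<phi> p)"
    by (rule arg_cong[where f = "word_act u"]) (simp add: uea_act_def linear_ext_def fun_eq_iff)
  also have "\<dots> = (\<lambda>p. \<Sum>w\<in>Poly_Mapping.keys a. Poly_Mapping.lookup a w * word_act u (word_act w \<phi>) p)"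
    by (rule actw_sum) (auto intro: smooth_actw that)
  finally have "word_act u (uea_act a \<phi>) p = linear_ext (\<lambda>w. word_act u (word_act w \<phi>) p) a" by (simp add: linear_ext_def)
  then show ?thesis by (simp add: uea_act_def[of "_ * _"] lext_single_mult actw_app)
qed

lemma ideal_act: 
  assumes "a \<in> ideal_gen uea_relations" "smooth \<phi>"
  shows "uea_act a \<phi> p = 0"
proof -
  let ?J = "{a. \<forall>\<phi> p. smooth \<phi> \<longrightarrow> uea_act a \<phi> p = 0}"
  have "two_sided_ideal ?J"
  proof (rule two_sided_ideal_monoid_alg)
    show "0 \<in> ?J" by (simp add: uea_act_def)
    show "x - y \<in> ?J" if "x \<in> ?J" "y \<in> ?J" for x y using that by (simp add: uea_act_def lext_minus)
    show "x * Poly_Mapping.single u c \<in> ?J" if "x \<in> ?J" for x u c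
      using that by (auto simp: uea_act_def lext_mult_single actw_app smooth_actw)
    show "Poly_Mapping.single u c * x \<in> ?J" if "x \<in> ?J" for x u c
    proof (clarsimp)
      fix \<phi> :: "spacetime \<Rightarrow> complex" and p assume s: "smooth \<phi>"
      have "uea_act x \<phi> = (\<lambda>_. 0 * 0)" using that s by auto
      then have "word_act u (uea_act x \<phi>) = (\<lambda>p. 0 * word_act u (\<lambda>_. 0) p)" using actw_cmul[OF smooth_const, of u 0 0] by simp
      then show "uea_act (Poly_Mapping.single u c * x) \<phi> p = 0" by (simp add: act_single_mult s)
    qed
  qed
  moreover have "uea_relations \<subseteq> ?J" using rel_act by blast
  ultimately show ?thesis using ideal_in assms by blast
qed

definition uea_eval :: "(spacetime \<Rightarrow> complex) \<Rightarrow> spacetime \<Rightarrow> uea \<Rightarrow> complex" where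
  "uea_eval \<phi> p u = uea_act (rep_uea u) \<phi> p"

lemma ev_abs: "smooth \<phi> \<Longrightarrow> uea_eval \<phi> p (abs_uea a) = uea_act a \<phi> p"
proof -
  assume s: "smooth \<phi>"
  have "rep_uea (abs_uea a) - a \<in> ideal_gen uea_relations"
    using Quotient3_uea unfolding Quotient3_def by (metis ideal_gen_zero diff_self)
  from ideal_act[OF this s, of p] show ?thesis by (simp add: uea_eval_def uea_act_def lext_minus)
qed

definition uea_linear :: "(uea \<Rightarrow> complex) \<Rightarrow> bool" where
  "uea_linear l \<longleftrightarrow> (\<forall>a b. l (a + b) = l a + l b) \<and> (\<forall>z a. l (uea_scale z a) = z * l a)"

lemma abs_surj: "\<exists>a. u = abs_uea a" using Quotient3_abs_rep[OF Quotient3_uea] by metis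

lemma lin_ev: assumes "smooth \<phi>" shows "uea_linear (uea_eval \<phi> p)"
  unfolding uea_linear_def
proof safe
  fix a b obtain x y where "a = abs_uea x" "b = abs_uea y" using abs_surj by metis
  then show "uea_eval \<phi> p (a + b) = uea_eval \<phi> p a + uea_eval \<phi> p b"
    using assms by (simp add: plus_uea.abs_eq ev_abs uea_act_def lext_add)
next
  fix a z obtain x where "a = abs_uea x" using abs_surj by metis
  then show "uea_eval \<phi> p (uea_scale z a) = z * uea_eval \<phi> p a"
    using assms by (simp add: uea_scale.abs_eq ev_abs uea_act_def lext_single_mult)
qed

lemma ev_gen: "smooth \<phi> \<Longrightarrow> uea_eval \<phi> p (uea_gen X) = vf_der X \<phi> p"
  by (simp add: uea_gen.abs_eq ev_abs uea_act_def)

lemma scale_mult: "uea_scale z (a * b) = uea_scale z a * b" "uea_scale z (a * b) = a * uea_scale z b" for a b :: uea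
proof -
  obtain x y where xy: "a = abs_uea x" "b = abs_uea y" using abs_surj by metis
  have c: "Poly_Mapping.single 0 z * x = x * Poly_Mapping.single 0 z" for x :: "vfield word \<Rightarrow>\<^sub>0 complex"
    by (induction x rule: poly_mapping_induct) (simp_all add: mult_single algebra_simps)
  show "uea_scale z (a * b) = uea_scale z a * b" using xy by (simp add: times_uea.abs_eq uea_scale.abs_eq mult.assoc)
  show "uea_scale z (a * b) = a * uea_scale z b" using xy
    by (simp add: times_uea.abs_eq uea_scale.abs_eq) (metis c mult.assoc)
qed

fun pair_functional :: "(uea \<Rightarrow> complex) \<Rightarrow> (uea \<Rightarrow> complex) \<Rightarrow> uea mkey \<times> uea mkey \<Rightarrow> complex" where
  "pair_functional l m (MKey a, MKey b) = l a * m b"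

lemma ideal2_pr:
  assumes "t \<in> ideal_gen uea2_relations" "uea_linear l" "uea_linear m"
  shows "linear_ext (pair_functional l m) t = 0"
proof -
  let ?J = "{t. \<forall>l m. uea_linear l \<longrightarrow> uea_linear m \<longrightarrow> linear_ext (pair_functional l m) t = 0}"
  have "two_sided_ideal ?J"
  proof (rule two_sided_ideal_monoid_alg)
    show "0 \<in> ?J" by simp
    show "x - y \<in> ?J" if "x \<in> ?J" "y \<in> ?J" for x y using that by (simp add: lext_minus)
    show "x * Poly_Mapping.single u c \<in> ?J" if x: "x \<in> ?J" for x u c
    proof safe
      fix l m assume lm: "uea_linear l" "uea_linear m"
      obtain a b where u: "u = (MKey a, MKey b)" by (metis mkey.exhaust surj_pair)
      have "(\<lambda>v. pair_functional l m (v + u)) = pair_functional (\<lambda>x. l (x * a)) (\<lambda>x. m (x * b))"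
      proof
        fix v :: "uea mkey \<times> uea mkey" obtain a' b' where "v = (MKey a', MKey b')" by (metis mkey.exhaust surj_pair)
        then show "pair_functional l m (v + u) = pair_functional (\<lambda>x. l (x * a)) (\<lambda>x. m (x * b)) v" by (simp add: u)
      qed
      moreover have "uea_linear (\<lambda>x. l (x * a))" "uea_linear (\<lambda>x. m (x * b))"
        using lm unfolding uea_linear_def by (simp_all add: distrib_right scale_mult(1)[symmetric])
      ultimately show "linear_ext (pair_functional l m) (x * Poly_Mapping.single u c) = 0" using x by (simp add: lext_mult_single)
    qed
    show "Poly_Mapping.single u c * x \<in> ?J" if x: "x \<in> ?J" for x u c
    proof safe
      fix l m assume lm: "uea_linear l" "uea_linear m"
      obtain a b where u: "u = (MKey a, MKey b)" by (metis mkey.exhaust surj_pair)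
      have "(\<lambda>v. pair_functional l m (u + v)) = pair_functional (\<lambda>x. l (a * x)) (\<lambda>x. m (b * x))"
      proof
        fix v :: "uea mkey \<times> uea mkey" obtain a' b' where "v = (MKey a', MKey b')" by (metis mkey.exhaust surj_pair)
        then show "pair_functional l m (u + v) = pair_functional (\<lambda>x. l (a * x)) (\<lambda>x. m (b * x)) v" by (simp add: u)
      qed
      moreover have "uea_linear (\<lambda>x. l (a * x))" "uea_linear (\<lambda>x. m (b * x))"
        using lm unfolding uea_linear_def by (simp_all add: distrib_left scale_mult(2)[symmetric])
      ultimately show "linear_ext (pair_functional l m) (Poly_Mapping.single u c * x) = 0" using x by (simp add: lext_single_mult)
    qed
  qed
  moreover have "uea2_relations \<subseteq> ?J"
    unfolding uea2_relations_def by (auto simp: lext_minus uea_linear_def distrib_left distrib_right)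
  ultimately show ?thesis using ideal_in assms by blast
qed

definition uea2_eval :: "(uea \<Rightarrow> complex) \<Rightarrow> (uea \<Rightarrow> complex) \<Rightarrow> uea2 \<Rightarrow> complex" where
  "uea2_eval l m u = linear_ext (pair_functional l m) (rep_uea2 u)"

lemma ev2_abs: assumes "uea_linear l" "uea_linear m" shows "uea2_eval l m (abs_uea2 a) = linear_ext (pair_functional l m) a"
proof -
  have "rep_uea2 (abs_uea2 a) - a \<in> ideal_gen uea2_relations"
    using Quotient3_uea2 unfolding Quotient3_def by (metis ideal_gen_zero diff_self)
  from ideal2_pr[OF this assms] show ?thesis by (simp add: uea2_eval_def lext_minus)
qed

lemma abs2_surj: "\<exists>a. u = abs_uea2 a" using Quotient3_abs_rep[OF Quotient3_uea2] by metis

lemma ev2_minus: assumes "uea_linear l" "uea_linear m" shows "uea2_eval l m (u - v) = uea2_eval l m u - uea2_eval l m v"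
proof -
  obtain x y where "u = abs_uea2 x" "v = abs_uea2 y" using abs2_surj by metis
  then show ?thesis using assms by (simp add: minus_uea2.abs_eq ev2_abs lext_minus)
qed

lemma ev2_scale: assumes "uea_linear l" "uea_linear m" shows "uea2_eval l m (uea2_scale z u) = z * uea2_eval l m u"
proof -
  obtain x where "u = abs_uea2 x" using abs2_surj by metis
  then show ?thesis using assms by (simp add: uea2_scale.abs_eq ev2_abs lext_single_mult)
qed

lemma ev2_tensor: assumes "uea_linear l" "uea_linear m" shows "uea2_eval l m (a \<otimes> b) = l a * m b"
  using assms by (simp add: tensor.abs_eq ev2_abs)

lemma twist_eq_imp:
  assumes "twist V1 V2 = twist W1 W2"
  shows "(vf_at V1 p \<bullet> b) * (vf_at V2 q \<bullet> c) - (vf_at V2 p \<bullet> b) * (vf_at V1 q \<bullet> c)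
       = (vf_at W1 p \<bullet> b) * (vf_at W2 q \<bullet> c) - (vf_at W2 p \<bullet> b) * (vf_at W1 q \<bullet> c)"
proof -
  let ?f = "\<lambda>b x. complex_of_real (x \<bullet> b)"
  have bl: "bounded_linear (?f b)" for b :: spacetime
    by (rule bounded_linear_compose[OF bounded_linear_of_real bounded_linear_inner_left])
  have sm: "smooth (?f b)" for b :: spacetime by (rule smooth_linear[OF bl])
  have fd: "frechet_derivative (?f b) (at p) = ?f b" for b p :: spacetime
    by (rule frechet_derivative_at[OF bounded_linear_imp_has_derivative[OF bl], symmetric])
  let ?l = "uea_eval (?f b) p" and ?m = "uea_eval (?f c) q"
  have lm: "uea_linear ?l" "uea_linear ?m" using lin_ev sm by blast+
  have "fps_nth (twist V1 V2) 1 = fps_nth (twist W1 W2) 1" using assms by simp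
  then have "uea2_eval ?l ?m (fps_nth (twist V1 V2) 1) = uea2_eval ?l ?m (fps_nth (twist W1 W2) 1)" by simp
  then show ?thesis
    by (simp add: twist_def fps_exp_lambda_def lm ev2_scale ev2_minus ev2_tensor ev_gen sm vf_der_def fd
        flip: of_real_mult of_real_diff)
qed

definition space_part :: "vfield \<Rightarrow> real ^ 3 \<Rightarrow> real ^ 3" where "space_part V x = snd (vf_at V (0, x))"
definition dilation_part :: "vfield \<Rightarrow> real" where "dilation_part V = (\<Sum>i\<in>UNIV. space_part V (axis i 1) $ i - space_part V 0 $ i)"

lemma twist_eq_tt:
  assumes "twist V1 V2 = twist W1 W2"
  shows "time_comp V1 p * time_comp V2 q - time_comp V2 p * time_comp V1 q
     = time_comp W1 p * time_comp W2 q - time_comp W2 p * time_comp W1 q"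
  using twist_eq_imp[OF assms, of p "(1, 0)" q "(1, 0)"] by (simp add: time_comp_def inner_prod_def)

lemma twist_eq_ts:
  assumes "twist V1 V2 = twist W1 W2"
  shows "time_comp V1 p * dilation_part V2 - time_comp V2 p * dilation_part V1 = time_comp W1 p * dilation_part W2 - time_comp W2 p * dilation_part W1"
proof -
  have *: "time_comp V1 p * space_part V2 x $ i - time_comp V2 p * space_part V1 x $ i = time_comp W1 p * space_part W2 x $ i - time_comp W2 p * space_part W1 x $ i" for x i
    using twist_eq_imp[OF assms, of p "(1, 0)" "(0, x)" "(0, axis i 1)"]
    by (simp add: time_comp_def space_part_def inner_prod_def inner_axis)
  have **: "time_comp V1 p * dilation_part V2 - time_comp V2 p * dilation_part V1 =
    (\<Sum>i\<in>UNIV. (time_comp V1 p * space_part V2 (axis i 1) $ i - time_comp V2 p * space_part V1 (axis i 1) $ i)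
       - (time_comp V1 p * space_part V2 0 $ i - time_comp V2 p * space_part V1 0 $ i))" for V1 V2
    unfolding dilation_part_def sum_distrib_left sum_subtractf[symmetric] by (rule sum.cong) (simp_all add: algebra_simps)
  show ?thesis unfolding ** * ..
qed

lemma twist_eq_ss:
  assumes "twist V1 V2 = twist W1 W2"
  shows "space_part V1 x $ j * dilation_part V2 - space_part V2 x $ j * dilation_part V1 = space_part W1 x $ j * dilation_part W2 - space_part W2 x $ j * dilation_part W1"
proof -
  have *: "space_part V1 x $ j * space_part V2 y $ i - space_part V2 x $ j * space_part V1 y $ i = space_part W1 x $ j * space_part W2 y $ i - space_part W2 x $ j * space_part W1 y $ i" for y i
    using twist_eq_imp[OF assms, of "(0, x)" "(0, axis j 1)" "(0, y)" "(0, axis i 1)"]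
    by (simp add: space_part_def inner_prod_def inner_axis)
  have **: "space_part V1 x $ j * dilation_part V2 - space_part V2 x $ j * dilation_part V1 =
    (\<Sum>i\<in>UNIV. (space_part V1 x $ j * space_part V2 (axis i 1) $ i - space_part V2 x $ j * space_part V1 (axis i 1) $ i)
       - (space_part V1 x $ j * space_part V2 0 $ i - space_part V2 x $ j * space_part V1 0 $ i))" for V1 V2
    unfolding dilation_part_def sum_distrib_left sum_subtractf[symmetric] by (rule sum.cong) (simp_all add: algebra_simps)
  show ?thesis unfolding ** * ..
qed

lemma comps:
  assumes "smooth f"
  shows "vf_at (time_field f) (t, x) = (f t, 0)"
  by (simp add: vf_at_time_field assms)

lemma dv_add: "dilation_part (X + Y) = dilation_part X + dilation_part Y" by (simp add: dilation_part_def space_part_def vf_at_add sum.distrib sum_subtractf algebra_simps)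
lemma dv_scaleR: "dilation_part (r *\<^sub>R X) = r * dilation_part X" by (simp add: dilation_part_def space_part_def vf_at_scaleR sum_3 algebra_simps)
lemma dv_time: "smooth f \<Longrightarrow> dilation_part (time_field f) = 0" by (simp add: dilation_part_def space_part_def comps)
lemma dv_trans: "dilation_part (trans_field f) = 0" by (simp add: dilation_part_def space_part_def vf_at_trans)
lemma dv_p: "dilation_part (\<Sum>i\<in>UNIV. c i *\<^sub>R p_field i) = 0" by (simp add: dv_add dv_scaleR sum_3) (simp add: dilation_part_def space_part_def p_field.rep_eq)
lemma dv_rot: "dilation_part (rot_field d) = 0" by (simp add: dilation_part_def space_part_def vf_at_rot sum_3 cross3_simps axis_def)
lemma dv_x: "dilation_part x_field = 3" by (simp add: dilation_part_def space_part_def vf_at_x sum_3 axis_def)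
lemmas dvs = dv_add dv_scaleR dv_time dv_trans dv_rot dv_x dv_p

lemma tc_add: "time_comp (X + Y) p = time_comp X p + time_comp Y p" by (simp add: time_comp_def vf_at_add)
lemma tc_scaleR: "time_comp (r *\<^sub>R X) p = r * time_comp X p" by (simp add: time_comp_def vf_at_scaleR)
lemma tc_time: "smooth f \<Longrightarrow> time_comp (time_field f) (t, x) = f t" by (simp add: time_comp_def comps)
lemma tc_trans: "time_comp (trans_field c) (t, x) = 0" by (simp add: time_comp_def vf_at_trans)
lemma tc_rot: "time_comp (rot_field c) (t, x) = 0" by (simp add: time_comp_def vf_at_rot)
lemma tc_x: "time_comp x_field (t, x) = 0" by (simp add: time_comp_def vf_at_x)
lemmas tcs = tc_add tc_scaleR tc_time tc_trans tc_rot tc_x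

theorem residual_not_listed:
  assumes r: "residual V1 V2" and w: "listed W1 W2" and eq: "twist V1 V2 = twist W1 W2"
  shows False
proof -
  obtain f g c1 d1 s where fg: "smooth f" "smooth g" "\<not> lin_dep_on UNIV f g" "s \<noteq> 0"
    and V: "V1 = time_field f + trans_field c1 + rot_field d1 + s *\<^sub>R x_field" "V2 = time_field g"
    using r unfolding residual_def by blast
  have nz: False if "\<forall>t. g t = 0" using fg(3) that unfolding lin_dep_on_def by (metis add_0 mult_zero_left mult_zero_right zero_neq_one)
  have nd: False if h: "\<forall>t t'. f t * g t' - g t * f t' = 0"
  proof -
    obtain t0 where "g t0 \<noteq> 0" using nz by blast
    moreover have "g t0 * f t + (- f t0) * g t = 0" for t using h[rule_format, of t t0] by (simp add: algebra_simps)
    ultimately show False using fg(3) unfolding lin_dep_on_def by blast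
  qed
  have V0: "time_comp V1 (t, x) = f t" "time_comp V2 (t, x) = g t" "dilation_part V1 = 3 * s" "dilation_part V2 = 0" "space_part V2 x = 0" for t x
    using fg by (simp_all add: V tcs dvs space_part_def comps)
  have tt: "f t * g t' - g t * f t' = time_comp W1 (t, 0) * time_comp W2 (t', 0) - time_comp W2 (t, 0) * time_comp W1 (t', 0)" for t t'
    using twist_eq_tt[OF eq, of "(t, 0)" "(t', 0)"] by (simp add: V0)
  have ts: "- (g t * (3 * s)) = time_comp W1 (t, 0) * dilation_part W2 - time_comp W2 (t, 0) * dilation_part W1" for t
    using twist_eq_ts[OF eq, of "(t, 0)"] by (simp add: V0)
  have ss: "0 = space_part W1 x $ j * dilation_part W2 - space_part W2 x $ j * dilation_part W1" for x j
    using twist_eq_ss[OF eq, of x j] by (simp add: V0)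
  have A: "\<not> (dilation_part W1 = 0 \<and> dilation_part W2 = 0)" using ts nz fg(4) by auto
  have B: "\<not> (\<forall>t. time_comp W1 (t, 0) = 0)" "\<not> (\<forall>t. time_comp W2 (t, 0) = 0)" by (rule notI, rule nd, simp add: tt)+
  consider "type_C11 W1 W2" | "type_C21 W1 W2" | "type_C31 W1 W2" | "type_C12 W1 W2" | "type_C22 W1 W2" | "type_C32 W1 W2"
    using w unfolding listed_def by blast
  then show False
  proof cases
    case 1 then show False using A unfolding type_C11_def by (auto simp: dvs)
  next
    case 2 then show False using B unfolding type_C21_def by (auto simp: tcs)
  next
    case 3 then show False using B unfolding type_C31_def by (auto simp: tcs)
  next
    case 4 then show False using A unfolding type_C12_def by (auto simp: dvs)
  next
    case 5 then show False using B unfolding type_C22_def by (auto simp: tcs)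
  next
    case 6
    then obtain f' g' d c2 f2 where C: "smooth f'" "smooth g'" "d \<noteq> 0" "f2 \<noteq> 0"
      "W1 = time_field f'
        + (1 / f2) *\<^sub>R (\<Sum>i\<in>UNIV. (\<Sum>j\<in>UNIV. \<Sum>k\<in>UNIV. d $ j * c2 $ k * levi_civita j k i) *\<^sub>R p_field i)
        + rot_field d"
      "W2 = time_field g' + trans_field c2 + f2 *\<^sub>R x_field" unfolding type_C32_def by blast
    have "dilation_part W1 = 0" "dilation_part W2 = 3 * f2" using C(1,2) unfolding C(5,6) by (simp_all add: dvs)
    then have "space_part W1 x = 0" for x using ss C(4) by (simp add: vec_eq_iff)
    moreover have "space_part W1 x - space_part W1 0 = cross3 d x" for x
      unfolding space_part_def C(5) using C(1)
      by (simp add: vf_at_add vf_at_scaleR comps vf_at_rot sum_3 p_field.rep_eq)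
    ultimately have "cross3 d x = 0" for x by simp
    from this[of "axis 1 1"] this[of "axis 2 1"] this[of "axis 3 1"] have "d = 0"
      by (simp add: cross3_simps vec_eq_iff forall_3 axis_def)
    then show False using C(3) by simp
  qed
qed

end

theory Submission
  imports Defs
begin

text \<open>For a field preserving \<open>e3\<close>, the brackets with translations make the spatial derivatives
  affine in \<open>x\<close> and independent of \<open>t\<close>; symmetry of second derivatives makes them constant, and
  the brackets with rotations leave only
  $V = f(t)\partial_t + c^i\partial_i + d^iL_i + s\,x^i\partial_i$. Two such fields commute iff the
  Wronskian of their time components vanishes, $d_2 \times d_1 = 0$ and
  $d_2 \times c_1 - d_1 \times c_2 + s_2 c_1 - s_1 c_2 = 0$. Shears of the pair generate
  $SL_2(\mathbb{R})$ and preserve the twist; they reduce first to $d_2 = 0$ and then, according to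
  which of $s_1, s_2, d_1$ vanish, to one of the six types, except that a time component of the
  dilating field can only be removed if the time components are linearly dependent.\<close>

section \<open>Smooth functions of one variable\<close>

lemma smooth_has_real_derivative:
  fixes f :: "real \<Rightarrow> real"
  assumes "smooth f"
  shows "(f has_real_derivative deriv f t) (at t)"
  using smooth_diff[OF assms] by (simp add: DERIV_deriv_iff_real_differentiable)

lemma smooth_deriv:
  fixes f :: "real \<Rightarrow> real"
  assumes "smooth f"
  shows "smooth (deriv f)"
proof -
  have "frechet_derivative f (at t) = (*) (deriv f t)" for t
    using frechet_derivative_at[OF smooth_has_real_derivative[OF assms, unfolded has_field_derivative_def]]
    by simp
  then have "deriv f = (\<lambda>t. frechet_derivative f (at t) 1)" by simp
  with smooth_dd[OF assms, of 1] show ?thesis by simp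
qed

lemma smooth_mult: "smooth f \<Longrightarrow> smooth g \<Longrightarrow> smooth (\<lambda>t. f t * g t :: real)"
  by (simp add: smooth_def Ck_bilinear[OF bounded_bilinear_mult])

lemma smooth_lin_comb:
  fixes f g :: "'a::real_normed_vector \<Rightarrow> real"
  assumes "smooth f" "smooth g"
  shows "smooth (\<lambda>x. a * f x + b * g x)"
  using assms by (intro smooth_add smooth_mult smooth_const)

lemma smooth_imp_continuous_on: "smooth f \<Longrightarrow> continuous_on S f"
  unfolding smooth_def by (metis Ck.simps(1) continuous_on_subset subset_UNIV)

lemma smooth_wronskian:
  fixes f g :: "real \<Rightarrow> real"
  assumes "smooth f" "smooth g"
  shows "smooth (\<lambda>t. f t * deriv g t - deriv f t * g t)"
  using smooth_add[OF smooth_mult[OF assms(1) smooth_deriv[OF assms(2)]]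
      smooth_scaleR_const[OF smooth_mult[OF smooth_deriv[OF assms(1)] assms(2)], of "-1"]]
  by simp

text \<open>By the quotient rule, the derivative of \<open>g / f\<close> is the Wronskian divided by
  the square of \<open>f\<close>, hence zero, and a function with zero derivative is constant on a
  convex set.\<close>

lemma proportional_on_interval:
  fixes f g :: "real \<Rightarrow> real"
  assumes f: "smooth f" and g: "smooth g"
    and W: "\<And>t. f t * deriv g t = deriv f t * g t"
    and I: "is_interval I" and nz: "\<And>t. t \<in> I \<Longrightarrow> f t \<noteq> 0"
  shows "\<exists>\<kappa>. \<forall>t\<in>I. g t = \<kappa> * f t"
proof -
  have "((\<lambda>t. g t / f t) has_field_derivative 0) (at t within I)" if "t \<in> I" for t
  proof -
    have "((\<lambda>t. g t / f t) has_field_derivative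
        (deriv g t * f t - g t * deriv f t) / (f t * f t)) (at t)"
      using nz[OF that] by (intro DERIV_divide smooth_has_real_derivative f g)
    then show ?thesis using W[of t] by (simp add: mult.commute has_field_derivative_at_within)
  qed
  moreover have "convex I" using I by (simp add: is_interval_convex)
  ultimately obtain \<kappa> where "\<And>t. t \<in> I \<Longrightarrow> g t / f t = \<kappa>"
    using has_field_derivative_zero_constant[of I "\<lambda>t. g t / f t"] by metis
  then have "\<forall>t\<in>I. g t = \<kappa> * f t" using nz by (metis nonzero_eq_divide_eq)
  then show ?thesis by blast
qed

lemma eventually_eq_imp_deriv_zero:
  fixes f :: "real \<Rightarrow> real"
  assumes "eventually (\<lambda>s. f s = 0) (nhds t)"
  shows "deriv f t = 0"
  using deriv_cong_ev[OF assms refl] by simp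

text \<open>On the closure of the set where neither function vanishes, the Wronskian vanishes by
  continuity; off that closure, one of the two functions vanishes locally.\<close>

lemma wronskian_zero_iff_local_dependence:
  fixes f g :: "real \<Rightarrow> real"
  assumes f: "smooth f" and g: "smooth g"
  shows "(\<forall>t. f t * deriv g t = deriv f t * g t) \<longleftrightarrow>
    (\<forall>I. is_interval I \<and> I \<subseteq> support_on UNIV f \<inter> support_on UNIV g \<longrightarrow> lin_dep_on I f g)"
    (is "?W \<longleftrightarrow> ?L")
proof
  assume W: ?W
  show ?L
  proof (intro allI impI)
    fix I assume I: "is_interval I \<and> I \<subseteq> support_on UNIV f \<inter> support_on UNIV g"
    then have "\<And>t. t \<in> I \<Longrightarrow> f t \<noteq> 0" by (auto simp: in_support_on)
    then obtain \<kappa> where "\<forall>t\<in>I. g t = \<kappa> * f t"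
      using proportional_on_interval[OF f g W[rule_format], of I] I by auto
    then show "lin_dep_on I f g"
      unfolding lin_dep_on_def by (intro exI[of _ \<kappa>] exI[of _ "-1"]) auto
  qed
next
  assume L: ?L
  let ?w = "\<lambda>t. f t * deriv g t - deriv f t * g t"
  let ?U = "{t. f t * g t \<noteq> 0}"
  have cfg: "continuous_on UNIV (\<lambda>t. f t * g t)"
    by (intro smooth_imp_continuous_on smooth_mult f g)
  have oU: "open ?U" by (rule open_Collect_neq[OF cfg continuous_on_const])
  have wU: "?w t = 0" if t: "t \<in> ?U" for t
  proof -
    obtain e where e: "0 < e" "ball t e \<subseteq> ?U" using oU t openE by blast
    have "is_interval (ball t e)" by (simp add: is_interval_convex_1)
    moreover have "ball t e \<subseteq> support_on UNIV f \<inter> support_on UNIV g"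
      using e(2) by (auto simp: in_support_on)
    ultimately have "lin_dep_on (ball t e) f g" using L by blast
    then obtain a b where ab: "a \<noteq> 0 \<or> b \<noteq> 0" "\<forall>x\<in>ball t e. a * f x + b * g x = 0"
      unfolding lin_dep_on_def by blast
    let ?h = "\<lambda>x. a * f x + b * g x"
    have "((\<lambda>x. a * f x + b * g x) has_real_derivative a * deriv f t + b * deriv g t) (at t)"
      using smooth_has_real_derivative[OF f] smooth_has_real_derivative[OF g]
      by (auto intro!: derivative_eq_intros)
    moreover have "deriv ?h t = 0"
      by (rule eventually_eq_imp_deriv_zero)
        (use ab(2) e(1) in \<open>auto simp: eventually_nhds_metric dist_commute\<close>)
    ultimately have "a * deriv f t + b * deriv g t = 0" using DERIV_imp_deriv by force
    moreover have "a * f t + b * g t = 0" using ab(2) e(1) by simp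
    \<comment> \<open>The relation and its derivative form a homogeneous linear system for
      \<open>(a, b)\<close> whose determinant is the Wronskian at \<open>t\<close>.\<close>
    ultimately have "a * ?w t = 0" "b * ?w t = 0" by algebra+
    then show ?thesis using ab(1) by auto
  qed
  have wC: "?w t = 0" if "t \<in> closure ?U" for t
    using continuous_constant_on_closure[of ?U ?w 0 t] wU that
      smooth_imp_continuous_on[OF smooth_wronskian[OF f g]] by blast
  have "?w t = 0" for t
  proof (cases "t \<in> closure ?U")
    case False
    then have ev: "eventually (\<lambda>s. s \<in> - closure ?U) (nhds t)"
      by (intro eventually_nhds_in_open) auto
    have fg: "eventually (\<lambda>s. f s * g s = 0) (nhds t)"
      using ev by eventually_elim (use closure_subset[of ?U] in auto)
    \<comment> \<open>Where one factor is nonzero, the other vanishes in a whole neighbourhood, so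
      its derivative vanishes too. \<open>f\<close> and \<open>g\<close> are taken in both roles; if
      both vanish at \<open>t\<close>, the Wronskian is trivially zero.\<close>
    have *: "deriv k t = 0 \<and> k t = 0"
      if h: "continuous_on UNIV h" "h t \<noteq> 0" and hk: "eventually (\<lambda>s. h s * k s = 0) (nhds t)"
      for h k :: "real \<Rightarrow> real"
    proof -
      have "open {s. h s \<noteq> 0}" by (rule open_Collect_neq[OF h(1) continuous_on_const])
      then have "eventually (\<lambda>s. s \<in> {s. h s \<noteq> 0}) (nhds t)"
        using h(2) by (intro eventually_nhds_in_open) auto
      with hk have k: "eventually (\<lambda>s. k s = 0) (nhds t)" by eventually_elim auto
      show ?thesis using eventually_eq_imp_deriv_zero[OF k] eventually_nhds_x_imp_x[OF k] by blast
    qed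
    have cf: "continuous_on UNIV f" and cg: "continuous_on UNIV g"
      using f g by (auto intro: smooth_imp_continuous_on)
    have gf: "eventually (\<lambda>s. g s * f s = 0) (nhds t)" using fg by (simp add: mult.commute)
    show ?thesis
      using *[OF cf _ fg] *[OF cg _ gf] by (cases "f t = 0"; cases "g t = 0") auto
  qed (use wC in blast)
  then show ?W by simp
qed

subsection \<open>Real-analytic functions\<close>

text \<open>Dividing by the power of \<open>x\<close> given by the subdegree leaves a function that
  is continuous at 0, where its value is the nonzero leading coefficient.\<close>

lemma has_fps_expansion_nonzero_isolated:
  fixes h :: "'a::{banach, real_normed_field} \<Rightarrow> 'a"
  assumes h: "h has_fps_expansion F" and F: "F \<noteq> 0"
  shows "eventually (\<lambda>x. h x \<noteq> 0) (at 0)"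
proof -
  let ?n = "subdegree F"
  let ?q = "\<lambda>x. if x = 0 then fps_nth F ?n else h x / x ^ ?n"
  have "?q has_fps_expansion fps_shift ?n F" by (rule has_fps_expansion_shift[OF h]) auto
  then have "isCont ?q 0" by (rule has_fps_expansion_imp_continuous)
  then have "?q \<midarrow>0\<rightarrow> ?q 0" by (simp only: isCont_def)
  moreover have "?q 0 \<noteq> 0" using F by simp
  ultimately have "eventually (\<lambda>x. ?q x \<noteq> 0) (at 0)" by (rule tendsto_imp_eventually_ne)
  moreover have "eventually (\<lambda>x. x \<noteq> 0) (at (0::'a))" by (rule eventually_neq_at_within)
  ultimately show ?thesis by eventually_elim auto
qed

text \<open>Identity theorem: the set \<open>?S\<close> of points near which \<open>h\<close>
  vanishes is open, and it contains every limit point of zeros, since a nonzero expansion there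
  would isolate them. Connectedness of the line makes \<open>?S\<close> everything.\<close>

lemma real_analytic_identity:
  assumes h: "real_analytic h" and t0: "eventually (\<lambda>t. h t = 0) (nhds t0)"
  shows "h t = 0"
proof -
  let ?S = "{t. eventually (\<lambda>s. h s = 0) (nhds t)}"
  have S: "eventually (\<lambda>s. h s = 0) (nhds t)" if lim: "t islimpt {s. h s = 0}" for t
  proof -
    obtain F where F: "(\<lambda>u. h (t + u)) has_fps_expansion F" using h unfolding real_analytic_def by blast
    have "F = 0"
    proof (rule ccontr)
      assume "F \<noteq> 0"
      then have "eventually (\<lambda>u. h (t + u) \<noteq> 0) (at 0)"
        by (rule has_fps_expansion_nonzero_isolated[OF F])
      then have "eventually (\<lambda>s. h s \<noteq> 0) (at t)"
        by (subst eventually_at_to_0) (simp add: add.commute)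
      then show False using lim by (simp add: islimpt_iff_eventually)
    qed
    then have "eventually (\<lambda>u. h (t + u) = 0) (nhds 0)"
      using F by (auto simp: has_fps_expansion_def elim!: eventually_mono)
    moreover have "((\<lambda>s. s - t) \<longlongrightarrow> t - t) (nhds t)"
      by (intro tendsto_diff filterlim_ident tendsto_const)
    ultimately have "eventually (\<lambda>s. h (t + (s - t)) = 0) (nhds t)"
      using eventually_compose_filterlim[of "\<lambda>u. h (t + u) = 0" "nhds 0" "\<lambda>s. s - t" "nhds t"] by simp
    then show ?thesis by simp
  qed
  have "open ?S"
    by (subst open_subopen) (auto simp: eventually_nhds)
  moreover have "closed ?S"
    unfolding closed_limpt
  proof (intro allI impI)
    fix t assume "t islimpt ?S"
    then have "t islimpt {s. h s = 0}"
      by (rule islimpt_subset) (use eventually_nhds_x_imp_x in blast)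
    then show "t \<in> ?S" using S by blast
  qed
  ultimately have "?S = UNIV" using t0 clopen[of ?S] by blast
  then show ?thesis using eventually_nhds_x_imp_x by blast
qed

text \<open>Proportionality holds on a ball around \<open>t0\<close> where \<open>f\<close> has no
  zero; the identity theorem for \<open>g t - \<kappa> * f t\<close> carries it to the whole
  line.\<close>

lemma real_analytic_proportional:
  assumes f: "smooth f" "real_analytic f" and g: "smooth g" "real_analytic g"
    and W: "\<And>t. f t * deriv g t = deriv f t * g t" and nz: "f t0 \<noteq> 0"
  shows "\<exists>\<kappa>. \<forall>t. g t = \<kappa> * f t"
proof -
  have "open {t. f t \<noteq> 0}"
    by (rule open_Collect_neq) (auto intro: smooth_imp_continuous_on f)
  then obtain e where e: "0 < e" "ball t0 e \<subseteq> {t. f t \<noteq> 0}" using nz openE by blast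
  moreover have "is_interval (ball t0 e)" by (simp add: is_interval_convex_1)
  ultimately obtain \<kappa> where k: "\<forall>t\<in>ball t0 e. g t = \<kappa> * f t"
    using proportional_on_interval[OF f(1) g(1) W, of "ball t0 e"] by blast
  have "real_analytic (\<lambda>t. g t - \<kappa> * f t)"
    unfolding real_analytic_def
  proof
    fix t
    obtain F G where "(\<lambda>u. f (t + u)) has_fps_expansion F" "(\<lambda>u. g (t + u)) has_fps_expansion G"
      using f(2) g(2) unfolding real_analytic_def by blast
    then have "(\<lambda>u. g (t + u) - \<kappa> * f (t + u)) has_fps_expansion G - fps_const \<kappa> * F"
      by (intro has_fps_expansion_diff has_fps_expansion_cmult_left)
    then show "\<exists>H. (\<lambda>u. g (t + u) - \<kappa> * f (t + u)) has_fps_expansion H" ..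
  qed
  moreover have "eventually (\<lambda>t. g t - \<kappa> * f t = 0) (nhds t0)"
    using k e(1) by (auto simp: eventually_nhds_metric dist_commute)
  ultimately have "g t - \<kappa> * f t = 0" for t by (rule real_analytic_identity)
  then show ?thesis by auto
qed

subsection \<open>A smooth function supported on a half-line\<close>

text \<open>The family \<open>p (1/x) exp (-1/x)\<close>, \<open>p\<close> a polynomial, is closed under differentiation.\<close>

definition flat_fun :: "real poly \<Rightarrow> real \<Rightarrow> real" where
  "flat_fun p x = (if 0 < x then poly p (1 / x) * exp (- (1 / x)) else 0)"

lemma poly_over_exp_tendsto_0: "((\<lambda>y. poly p y * exp (- y)) \<longlongrightarrow> (0::real)) at_top"
proof -
  have "((\<lambda>y. \<Sum>i\<le>degree p. coeff p i * (y ^ i / exp y)) \<longlongrightarrow> (\<Sum>i\<le>degree p. coeff p i * 0)) at_top"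
    by (intro tendsto_intros tendsto_power_div_exp_0)
  then show ?thesis by (simp add: poly_altdef sum_distrib_right exp_minus divide_inverse mult.assoc)
qed

lemma flat_fun_tendsto_0: "(flat_fun p \<longlongrightarrow> 0) (at 0)"
proof -
  have "((\<lambda>x. poly p (1 / x) * exp (- (1 / x))) \<longlongrightarrow> 0) (at_right 0)"
    using filterlim_compose[OF poly_over_exp_tendsto_0 filterlim_inverse_at_top_right]
    by (simp add: inverse_eq_divide)
  then have "(flat_fun p \<longlongrightarrow> 0) (at_right 0)"
    by (rule Lim_transform_eventually)
      (auto simp: flat_fun_def eventually_at_right_field intro!: exI[of _ 1])
  moreover have "(flat_fun p \<longlongrightarrow> 0) (at_left 0)"
    by (rule Lim_transform_eventually[OF tendsto_const])
      (auto simp: flat_fun_def eventually_at_left_field intro!: exI[of _ "-1"])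
  ultimately show ?thesis by (simp add: filterlim_split_at_real)
qed

text \<open>For \<open>y = 1/x\<close> one has \<open>y' = -y^2\<close>, so
  \<open>p(y) exp(-y)\<close> has the derivative \<open>y^2 (p(y) - p'(y)) exp(-y)\<close>.\<close>

lemma flat_fun_has_derivative:
  "(flat_fun p has_real_derivative flat_fun ([:0, 0, 1:] * (p - pderiv p)) x) (at x)"
proof (cases x "0 :: real" rule: linorder_cases)
  case less
  have "((\<lambda>_. 0) has_real_derivative 0) (at x)" by simp
  then have "(flat_fun p has_real_derivative 0) (at x)"
    by (rule has_field_derivative_transform_within_open[of _ _ _ "{..<0}"])
      (use less in \<open>auto simp: flat_fun_def\<close>)
  then show ?thesis using less by (simp add: flat_fun_def)
next
  case equal
  \<comment> \<open>The difference quotient at 0 belongs to the same family: the factor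
    \<open>1 / h\<close> multiplies the polynomial by its variable. Hence it tends to 0.\<close>
  have "(\<lambda>h. (flat_fun p (0 + h) - flat_fun p 0) / h) = flat_fun ([:0, 1:] * p)"
    by (auto simp: flat_fun_def)
  then have "(flat_fun p has_real_derivative 0) (at 0)"
    using flat_fun_tendsto_0[of "[:0, 1:] * p"] by (simp only: DERIV_def)
  then show ?thesis using equal by (simp add: flat_fun_def)
next
  case greater
  have "((\<lambda>x. poly p (1 / x) * exp (- (1 / x))) has_real_derivative
      flat_fun ([:0, 0, 1:] * (p - pderiv p)) x) (at x)"
    using greater
    by (auto intro!: derivative_eq_intros DERIV_chain2[OF poly_DERIV]
        simp: flat_fun_def field_simps power2_eq_square)
  then show ?thesis
    by (rule has_field_derivative_transform_within_open[of _ _ _ "{0<..}"])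
      (use greater in \<open>auto simp: flat_fun_def\<close>)
qed

lemma smooth_flat_fun: "smooth (flat_fun p)"
proof -
  \<comment> \<open>The scalar \<open>c\<close> is carried through the induction because the
    derivative in direction \<open>v\<close> brings in the factor \<open>v\<close>.\<close>
  have "Ck k (\<lambda>x. c * flat_fun p x)" for k c
  proof (induction k arbitrary: c p)
    case 0
    have "isCont (flat_fun p) x" for x by (rule DERIV_isCont[OF flat_fun_has_derivative])
    then have "isCont (\<lambda>x. c * flat_fun p x) x" for x by simp
    then show ?case by (simp add: continuous_at_imp_continuous_on)
  next
    case (Suc k)
    let ?q = "[:0, 0, 1:] * (p - pderiv p)"
    have D: "((\<lambda>x. c * flat_fun p x) has_derivative (*) (c * flat_fun ?q x)) (at x)" for x
      using DERIV_cmult[OF flat_fun_has_derivative] by (simp add: has_field_derivative_def)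
    have fd: "frechet_derivative (\<lambda>x. c * flat_fun p x) (at x) v = (c * v) * flat_fun ?q x" for x v
      using fun_cong[OF frechet_derivative_at[OF D, of x], of v] by (simp only: mult_ac)
    show ?case unfolding Ck.simps fd using Suc.IH[of "c * _" ?q] D differentiableI by blast
  qed
  from this[of _ 1] show ?thesis by (simp add: smooth_def)
qed

text \<open>\<open>flat_fun 1\<close> is \<open>exp (-1/x)\<close> on the positive half-line, and
  its mirror image lives on the negative one. Evaluation at 1 and -1 forces both coefficients of a
  linear relation to vanish.\<close>

lemma ex_smooth_disjoint_supports:
  "\<exists>f g :: real \<Rightarrow> real. smooth f \<and> smooth g \<and>
     support_on UNIV f \<inter> support_on UNIV g = {} \<and> \<not> lin_dep_on UNIV f g"
proof (intro exI conjI)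
  let ?f = "flat_fun 1" and ?g = "\<lambda>x. flat_fun 1 (- x)"
  show "smooth ?f" by (rule smooth_flat_fun)
  show "smooth ?g"
    using smooth_linear_right[OF bounded_linear_minus[OF bounded_linear_ident] smooth_flat_fun] by simp
  show "support_on UNIV ?f \<inter> support_on UNIV ?g = {}"
    by (auto simp: in_support_on flat_fun_def split: if_splits)
  show "\<not> lin_dep_on UNIV ?f ?g"
  proof
    assume "lin_dep_on UNIV ?f ?g"
    then obtain a b where ab: "a \<noteq> 0 \<or> b \<noteq> 0" "\<And>x. a * ?f x + b * ?g x = 0"
      unfolding lin_dep_on_def by blast
    show False using ab(1) ab(2)[of 1] ab(2)[of "-1"] by (simp add: flat_fun_def)
  qed
qed

section \<open>Vector fields preserving the Euclidean algebra\<close>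

unbundle cross3_syntax

text \<open>The spatial part is a general infinitesimal similarity of Euclidean space. Elements of
  \<open>e3\<close> and all pairs to be classified have this form, which reduces the calculus of
  vector fields to algebra with \<open>(f, c, d, s)\<close>.\<close>

definition similitude_field :: "(real \<Rightarrow> real) \<Rightarrow> real ^ 3 \<Rightarrow> real ^ 3 \<Rightarrow> real \<Rightarrow> vfield" where
  "similitude_field f c d s = time_field f + trans_field c + rot_field d + s *\<^sub>R x_field"

section \<open>Algebra of similitude fields\<close>

lemma vfield_eqI: "(\<And>p. vf_at X p = vf_at Y p) \<Longrightarrow> X = Y"
  by (simp add: vf_at_inject[symmetric] fun_eq_iff)

lemma vf_at_similitude:
  assumes "smooth f"
  shows "vf_at (similitude_field f c d s) p = (f (fst p), c + d \<times> snd p + s *\<^sub>R snd p)"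
  using assms by (cases p)
    (simp add: similitude_field_def vf_at_add vf_at_scaleR comps vf_at_trans vf_at_rot vf_at_x)

lemma trans_field_zero [simp]: "trans_field 0 = 0"
  by (simp add: trans_field_def)

lemma rot_field_zero [simp]: "rot_field 0 = 0"
  by (simp add: rot_field_def)

lemma time_field_zero [simp]: "time_field (\<lambda>_. 0) = 0"
  by (rule vfield_eqI) (simp add: vf_at_time_field smooth_const zero_vfield.rep_eq zero_prod_def split_beta)

lemma p_field_eq_similitude: "p_field i = similitude_field (\<lambda>_. 0) (axis i 1) 0 0"
proof (rule vfield_eqI)
  fix p :: spacetime
  show "vf_at (p_field i) p = vf_at (similitude_field (\<lambda>_. 0) (axis i 1) 0 0) p"
    by (cases p) (simp add: vf_at_similitude[OF smooth_const] p_field.rep_eq)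
qed

lemma L_field_eq_similitude: "L_field i = similitude_field (\<lambda>_. 0) 0 (axis i 1) 0"
proof -
  have "rot_field (axis i 1) = L_field i"
    by (simp add: rot_field_def axis_def if_distrib[of "\<lambda>r. r *\<^sub>R _"] cong: if_cong)
  then show ?thesis by (simp add: similitude_field_def)
qed

lemma similitude_lin_comb:
  assumes "smooth f" "smooth g"
  shows "a *\<^sub>R similitude_field f c d s + b *\<^sub>R similitude_field g c' d' s' =
    similitude_field (\<lambda>t. a * f t + b * g t) (a *\<^sub>R c + b *\<^sub>R c') (a *\<^sub>R d + b *\<^sub>R d') (a * s + b * s')"
  by (rule vfield_eqI)
    (simp add: vf_at_add vf_at_scaleR vf_at_similitude assms smooth_lin_comb algebra_simps
      cross_add_left cross_mult_left)

lemma similitude_field_zero: "similitude_field (\<lambda>_. 0) 0 0 0 = 0"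
  by (simp add: similitude_field_def)

lemma bounded_linear_cross_right: "bounded_linear (\<lambda>x. d \<times> x)"
  by (rule linear_linear[THEN iffD2], rule linearI) (simp_all add: cross_add_right cross_mult_right)

lemma frechet_derivative_similitude:
  assumes f: "smooth f"
  shows "frechet_derivative (vf_at (similitude_field f c d s)) (at p) v =
    (deriv f (fst p) * fst v, d \<times> snd v + s *\<^sub>R snd v)"
proof -
  have eq: "vf_at (similitude_field f c d s) = (\<lambda>p. (f (fst p), c + d \<times> snd p + s *\<^sub>R snd p))"
    by (simp add: fun_eq_iff vf_at_similitude f)
  have 1: "((\<lambda>p::spacetime. f (fst p)) has_derivative (\<lambda>v. deriv f (fst p) * fst v)) (at p)"
    by (rule has_derivative_compose[OF bounded_linear_imp_has_derivative[OF bounded_linear_fst]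
        smooth_has_real_derivative[OF f, unfolded has_field_derivative_def]])
  have 2: "((\<lambda>p::spacetime. d \<times> snd p) has_derivative (\<lambda>v. d \<times> snd v)) (at p)"
    by (rule bounded_linear_imp_has_derivative
        bounded_linear_compose[OF bounded_linear_cross_right bounded_linear_snd])+
  have "(vf_at (similitude_field f c d s) has_derivative
      (\<lambda>v. (deriv f (fst p) * fst v, d \<times> snd v + s *\<^sub>R snd v))) (at p)"
    unfolding eq by (auto intro!: derivative_eq_intros 1 2)
  from fun_cong[OF frechet_derivative_at[OF this], of v] show ?thesis by simp
qed

lemma cross_jacobi: "(a \<times> b) \<times> x = a \<times> (b \<times> x) - b \<times> (a \<times> x)" for a b x :: "real ^ 3"
  by (simp add: cross3_simps forall_3)

text \<open>The time part is the Wronskian. The spatial parts are affine: two rotations have a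
  rotation as commutator, by \<open>cross_jacobi\<close>, while dilations commute with every linear
  map, so no dilation remains.\<close>

lemma bracket_similitude:
  assumes f: "smooth f" and g: "smooth g"
  shows "bracket (similitude_field f c d s) (similitude_field g c' d' s') =
    similitude_field (\<lambda>t. f t * deriv g t - deriv f t * g t)
      (d' \<times> c - d \<times> c' + s' *\<^sub>R c - s *\<^sub>R c') (d' \<times> d) 0"
  by (rule vfield_eqI)
    (simp add: bracket.rep_eq vf_at_similitude frechet_derivative_similitude f g smooth_wronskian
      cross_jacobi cross_add_right cross_mult_right, simp add: algebra_simps)

lemma similitude_field_eq_zero:
  assumes f: "smooth f" and 0: "similitude_field f c d s = 0"
  shows "f t = 0" "c = 0" "d = 0"
proof -
  have z: "(f (fst p), c + d \<times> snd p + s *\<^sub>R snd p) = 0" for p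
    using arg_cong[OF 0, of "\<lambda>X. vf_at X p"] by (simp add: vf_at_similitude f zero_vfield.rep_eq)
  show "f t = 0" using z[of "(t, 0)"] by (simp add: zero_prod_def)
  show c: "c = 0" using z[of "(0, 0)"] by (simp add: zero_prod_def)
  have "d \<times> axis i 1 + s *\<^sub>R axis i 1 = 0" for i
    using z[of "(0, axis i 1)"] c by (simp add: zero_prod_def)
  from this[of 1] this[of 2] this[of 3] show "d = 0"
    by (simp add: cross3_simps forall_3 axis_def)
qed

lemma time_field_eq_similitude: "time_field f = similitude_field f 0 0 0"
  by (simp add: similitude_field_def)

lemma time_commute_iff:
  assumes "smooth f" "smooth g"
  shows "time_commute f g \<longleftrightarrow> (\<forall>t. f t * deriv g t = deriv f t * g t)"
  unfolding time_commute_def time_field_eq_similitude bracket_similitude[OF assms]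
  using similitude_field_eq_zero(1)[OF smooth_wronskian[OF assms]]
  by (auto simp: similitude_field_zero)

lemma e3_eq: "e3 = {similitude_field (\<lambda>_. 0) c d 0 | c d. True}" (is "_ = ?R")
proof
  have "0 \<in> ?R" using similitude_field_zero by force
  moreover have "x + y \<in> ?R" "r *\<^sub>R x \<in> ?R" if xy: "x \<in> ?R" "y \<in> ?R" for x y r
  proof -
    obtain c d c' d' where xy: "x = similitude_field (\<lambda>_. 0) c d 0" "y = similitude_field (\<lambda>_. 0) c' d' 0"
      using xy by blast
    have "x + y = similitude_field (\<lambda>_. 0) (c + c') (d + d') 0"
      unfolding xy using similitude_lin_comb[OF smooth_const smooth_const, of 1 0 c d 0 1 0 c' d' 0] by simp
    then show "x + y \<in> ?R" by blast
    have "r *\<^sub>R x = similitude_field (\<lambda>_. 0) (r *\<^sub>R c) (r *\<^sub>R d) 0"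
      unfolding xy using similitude_lin_comb[OF smooth_const smooth_const, of r 0 c d 0 0 0 0 0 0] by simp
    then show "r *\<^sub>R x \<in> ?R" by blast
  qed
  ultimately have "subspace ?R" unfolding subspace_def by blast
  then show "e3 \<subseteq> ?R"
    unfolding e3_def by (rule span_minimal[rotated]) (auto simp: p_field_eq_similitude L_field_eq_similitude)
  have "p_field i \<in> e3" "L_field i \<in> e3" for i
    unfolding e3_def by (auto intro: span_base)
  then have "trans_field c \<in> e3" "rot_field d \<in> e3" for c d
    unfolding e3_def trans_field_def rot_field_def by (simp_all add: span_sum span_scale)
  then show "?R \<subseteq> e3"
    unfolding e3_def similitude_field_def by (auto simp: span_add)
qed

text \<open>The time component is bracketed with zero and drops out, and a bracket has no dilation
  part, so the result stays in \<open>e3\<close>.\<close>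

lemma preserves_e3_similitude:
  assumes "smooth f"
  shows "preserves_e3 (similitude_field f c d s)"
proof -
  have "bracket (similitude_field f c d s) (similitude_field (\<lambda>_. 0) c' d' 0) =
      similitude_field (\<lambda>_. 0) (d' \<times> c - d \<times> c' - s *\<^sub>R c') (d' \<times> d) 0" for c' d'
    by (simp add: bracket_similitude[OF assms smooth_const])
  then show ?thesis unfolding preserves_e3_def e3_eq by blast
qed

text \<open>\<open>p_field i\<close> being constant, its bracket with \<open>V\<close> is minus the
  derivative of \<open>V\<close> along the \<open>i\<close>-th axis. Membership in \<open>e3\<close>
  makes this derivative purely spatial, with values \<open>a i + b i \<times> x\<close>.\<close>

lemma preserves_e3_spatial_derivative:
  assumes V: "preserves_e3 V"
  shows "\<exists>a. \<forall>p x. frechet_derivative (vf_at V) (at p) (0, x) = (0, \<Sum>i\<in>UNIV. x $ i *\<^sub>R a i)"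
proof -
  let ?D = "\<lambda>p. frechet_derivative (vf_at V) (at p)"
  have "\<exists>a b. \<forall>p. ?D p (0, axis i 1) = (0, a + b \<times> snd p)" for i
  proof -
    have "p_field i \<in> e3" unfolding e3_def by (intro span_base) auto
    then have "bracket V (p_field i) \<in> e3" using V unfolding preserves_e3_def by blast
    then obtain c d where cd: "bracket V (p_field i) = similitude_field (\<lambda>_. 0) c d 0"
      unfolding e3_eq by blast
    have "?D p (0, axis i 1) = (0, (- c) + (- d) \<times> snd p)" for p
    proof -
      have "vf_at (bracket V (p_field i)) p = - ?D p (0, axis i 1)"
        unfolding p_field_eq_similitude bracket.rep_eq frechet_derivative_similitude[OF smooth_const]
        by (simp add: vf_at_similitude smooth_const zero_prod_def)
      then have "- ?D p (0, axis i 1) = (0, c + d \<times> snd p)"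
        by (simp add: cd vf_at_similitude smooth_const)
      then have "?D p (0, axis i 1) = - (0, c + d \<times> snd p)" by (metis minus_minus)
      then show ?thesis by simp
    qed
    then show ?thesis by blast
  qed
  then obtain a b where ab: "\<And>i p. ?D p (0, axis i 1) = (0, a i + b i \<times> snd p)" by metis
  text \<open>The second derivatives \<open>b i \<times> e\<^sub>j\<close> are symmetric in \<open>i\<close>, \<open>j\<close>, which forces \<open>b = 0\<close>.\<close>
  have sym: "b i \<times> axis j 1 = b j \<times> axis i 1" for i j
  proof -
    have "(b i \<times> axis j 1) $ k = (b j \<times> axis i 1) $ k" for k
    proof -
      let ?h = "\<lambda>q :: spacetime. snd q $ k"
      have bl: "bounded_linear ?h"
        by (rule bounded_linear_compose[OF bounded_linear_vec_nth bounded_linear_snd])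
      let ?\<phi> = "\<lambda>q. ?h (vf_at V q)"
      have fd: "(\<lambda>q. frechet_derivative ?\<phi> (at q) (0, axis i 1)) = (\<lambda>q. (a i + b i \<times> snd q) $ k)" for i
        unfolding fd_lin[OF bl smooth_vf] ab by simp
      have "frechet_derivative (\<lambda>q::spacetime. (a i + b i \<times> snd q) $ k) (at 0) v = (b i \<times> snd v) $ k" for i v
      proof -
        have "bounded_linear (\<lambda>q::spacetime. (b i \<times> snd q) $ k)"
          by (rule bounded_linear_compose[OF bounded_linear_vec_nth
              bounded_linear_compose[OF bounded_linear_cross_right bounded_linear_snd]])
        note has_derivative_add[OF has_derivative_const bounded_linear_imp_has_derivative[OF this], of "a i $ k" "at 0"]
        from fun_cong[OF frechet_derivative_at[OF this], of v] show ?thesis by simp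
      qed
      note second = this
      show ?thesis
        using second_derivative_symmetric_real[OF smooth_linear_left[OF bl smooth_vf],
            of V "(0, axis i 1)" 0 "(0, axis j 1)"]
        unfolding fd second by simp
    qed
    then show ?thesis by (simp add: vec_eq_iff)
  qed
  \<comment> \<open>The tensor \<open>(b i \<times> axis j 1) $ k\<close> is symmetric in
    \<open>i\<close>, \<open>j\<close> and skew in \<open>j\<close>, \<open>k\<close>, hence
    zero.\<close>
  have b0: "b i = 0" for i
    using sym[of 1 2] sym[of 1 3] sym[of 2 3] exhaust_3[of i]
    by (auto simp: cross3_simps forall_3 axis_def)
  have "?D p (0, x) = (0, \<Sum>i\<in>UNIV. x $ i *\<^sub>R a i)" for p x
  proof -
    have lin: "linear (?D p)" by (rule linear_frechet_derivative[OF smooth_diff[OF smooth_vf]])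
    have "(0, x) = (\<Sum>i\<in>UNIV. x $ i *\<^sub>R (0 :: real, axis i 1 :: real ^ 3))"
      by (simp add: sum_3 vec_eq_iff forall_3 axis_def)
    then have "?D p (0, x) = (\<Sum>i\<in>UNIV. x $ i *\<^sub>R ?D p (0, axis i 1))"
      by (simp only: linear_sum[OF lin] linear_cmul[OF lin])
    then show ?thesis by (simp add: ab b0 sum_3)
  qed
  then show ?thesis by blast
qed

text \<open>Integrating the constant spatial derivative gives
  \<open>V(t, x) = V(t, 0) + (0, A x)\<close>. In the brackets with rotations, the value at
  \<open>x = 0\<close> shows that the spatial part of \<open>V(t, 0)\<close> does not depend on
  \<open>t\<close>, and the linear part shows that \<open>A\<close> is skew up to a multiple of the
  identity.\<close>

theorem preserves_e3_imp_similitude: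
  assumes V: "preserves_e3 V"
  shows "\<exists>f c d s. smooth f \<and> V = similitude_field f c d s"
proof -
  let ?D = "\<lambda>p. frechet_derivative (vf_at V) (at p)"
  obtain a where D: "\<And>p x. ?D p (0, x) = (0, \<Sum>i\<in>UNIV. x $ i *\<^sub>R a i)"
    using preserves_e3_spatial_derivative[OF V] by blast
  define A where "A x = (\<Sum>i\<in>UNIV. x $ i *\<^sub>R a i)" for x :: "real ^ 3"
  note D = D[folded A_def]
  have A: "bounded_linear A"
    unfolding A_def by (intro bounded_linear_sum bounded_linear_scaleR_left[THEN bounded_linear_compose] bounded_linear_vec_nth)
  define f where "f t = fst (vf_at V (t, 0))" for t
  have f: "smooth f"
    unfolding f_def
    by (rule smooth_linear_left[OF bounded_linear_fst
          smooth_linear_right[OF bounded_linear_Pair[OF bounded_linear_ident bounded_linear_zero] smooth_vf]])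
  have x: "vf_at V (t, x) = vf_at V (t, 0) + (0, A x)" for t x
  proof -
    have "((\<lambda>x. vf_at V (t, x) - (0, A x)) has_derivative (\<lambda>v. 0)) (at x)" for x
    proof -
      have "((\<lambda>x. vf_at V (t, x)) has_derivative (\<lambda>v. ?D (t, x) (0, v))) (at x)"
        by (rule has_derivative_compose[OF _ smooth_D'[OF smooth_vf]])
          (auto intro!: derivative_eq_intros)
      moreover have "((\<lambda>x. (0 :: real, A x)) has_derivative (\<lambda>v. (0, A v))) (at x)"
        by (rule bounded_linear_imp_has_derivative[OF bounded_linear_Pair[OF bounded_linear_zero A]])
      ultimately have "((\<lambda>x. vf_at V (t, x) - (0, A x)) has_derivative
          (\<lambda>v. ?D (t, x) (0, v) - (0, A v))) (at x)"
        by (rule has_derivative_diff)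
      then show ?thesis by (simp add: D)
    qed
    then obtain k where "\<And>x. vf_at V (t, x) - (0, A x) = k"
      using has_derivative_zero_constant[of UNIV "\<lambda>x. vf_at V (t, x) - (0, A x)"] by auto
    from this[of x] this[of 0] show ?thesis
      using bounded_linear.linear[OF A, THEN linear_0] by (simp add: algebra_simps)
  qed
  have rot: "\<exists>a' b'. \<forall>t x. e \<times> snd (vf_at V (t, x)) - A (e \<times> x) = a' + b' \<times> x" for e
  proof -
    let ?X = "similitude_field (\<lambda>_. 0) 0 e 0"
    have "?X \<in> e3" unfolding e3_eq by blast
    then have "bracket V ?X \<in> e3" using V unfolding preserves_e3_def by blast
    then obtain a' b' where ab: "bracket V ?X = similitude_field (\<lambda>_. 0) a' b' 0"
      unfolding e3_eq by blast
    have "e \<times> snd (vf_at V (t, x)) - A (e \<times> x) = a' + b' \<times> x" for t x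
    proof -
      have "vf_at (bracket V ?X) (t, x) = (0, e \<times> snd (vf_at V (t, x)) - A (e \<times> x))"
        unfolding bracket.rep_eq frechet_derivative_similitude[OF smooth_const]
          vf_at_similitude[OF smooth_const] by (simp add: D)
      then show ?thesis by (simp add: ab vf_at_similitude smooth_const)
    qed
    then show ?thesis by blast
  qed
  define c where "c = snd (vf_at V (0, 0))"
  have A0: "A 0 = 0" using bounded_linear.linear[OF A] by (rule linear_0)
  have c: "snd (vf_at V (t, 0)) = c" for t
  proof -
    have "e \<times> snd (vf_at V (t, 0)) = e \<times> c" for e
    proof -
      obtain a' b' where "\<And>t x. e \<times> snd (vf_at V (t, x)) - A (e \<times> x) = a' + b' \<times> x"
        using rot[of e] by blast
      from this[of t 0] this[of 0 0] show ?thesis by (simp add: A0 c_def)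
    qed
    from this[of "axis 1 1"] this[of "axis 2 1"] show ?thesis
      by (simp add: cross3_simps forall_3 axis_def)
  qed
  \<comment> \<open>The scalar product with \<open>x\<close> eliminates the unknown rotation
    \<open>b' \<times> x\<close> and leaves a condition on \<open>A\<close> alone.\<close>
  have "x \<bullet> (e \<times> A x) = x \<bullet> A (e \<times> x)" for e x
  proof -
    obtain a' b' where ab: "\<And>t x. e \<times> snd (vf_at V (t, x)) - A (e \<times> x) = a' + b' \<times> x"
      using rot[of e] by blast
    have "a' = e \<times> c" using ab[of 0 0] by (simp add: A0 c)
    moreover have "e \<times> (c + A x) - A (e \<times> x) = a' + b' \<times> x"
      using ab[of 0 x] unfolding x[of 0 x] by (simp add: c)
    ultimately have "e \<times> A x = A (e \<times> x) + b' \<times> x" by (simp add: cross_add_right algebra_simps)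
    then show ?thesis by (simp add: inner_add_right dot_cross_self)
  qed
  note skew = this
  \<comment> \<open>The \<open>a i\<close> are the columns of \<open>A\<close>; \<open>d\<close> is
    the axial vector of its skew part, read off from one entry of each off-diagonal pair.\<close>
  define d :: "real ^ 3" where "d = vector [a 2 $ 3, a 3 $ 1, a 1 $ 2]"
  \<comment> \<open>Basis vectors as test vectors make the off-diagonal entries antisymmetric; sums
    of two of them then make the diagonal entries equal.\<close>
  have sk: "a 1 $ 3 = - a 3 $ 1" "a 1 $ 2 = - a 2 $ 1" "a 2 $ 3 = - a 3 $ 2"
    using skew[of "axis 1 1" "axis 2 1"] skew[of "axis 1 1" "axis 3 1"] skew[of "axis 2 1" "axis 1 1"]
    by (simp_all add: A_def cross3_simps axis_def)
  have dg: "a 1 $ 1 = a 2 $ 2" "a 2 $ 2 = a 3 $ 3"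
    using skew[of "axis 1 1 + axis 2 1" "axis 3 1"] skew[of "axis 2 1 + axis 3 1" "axis 1 1"] sk
    by (simp_all add: A_def cross3_simps axis_def)
  have Ax: "A x = d \<times> x + (a 1 $ 1) *\<^sub>R x" for x
    using sk dg by (simp add: A_def d_def cross3_simps forall_3)
  have "V = similitude_field f c d (a 1 $ 1)"
  proof (rule vfield_eqI)
    fix p :: spacetime
    show "vf_at V p = vf_at (similitude_field f c d (a 1 $ 1)) p"
      using x[of "fst p" "snd p"]
      by (simp add: vf_at_similitude f prod_eq_iff f_def c Ax add.assoc)
  qed
  with f show ?thesis by blast
qed

section \<open>Pairs with the same twist\<close>

text \<open>The shear adds only multiples of the tensor square of \<open>V2\<close>, which cancel in
  the antisymmetric combination.\<close>

lemma twist_shear_left: "twist (V1 - \<kappa> *\<^sub>R V2) V2 = twist V1 V2"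
proof -
  have "V1 - \<kappa> *\<^sub>R V2 = V1 + (- \<kappa>) *\<^sub>R V2" by simp
  then show ?thesis
    by (simp only: twist_def uea_gen_add uea_gen_scaleR tensor_add_left tensor_add_right
        tensor_scale_left tensor_scale_right)
      (simp add: algebra_simps)
qed

text \<open>A quarter turn is a product of three shears.\<close>

lemma twist_rotate: "twist V2 (- V1) = twist V1 V2"
proof -
  have "twist V1 V2 = twist (V1 - (- 1) *\<^sub>R V2) (V2 - 1 *\<^sub>R (V1 - (- 1) *\<^sub>R V2))"
    by (simp only: twist_shear twist_shear_left)
  also have "\<dots> = twist (V1 + V2) (- V1)" by simp
  also have "\<dots> = twist ((V1 + V2) - (- 1) *\<^sub>R (- V1)) (- V1)" by (simp only: twist_shear_left)
  also have "\<dots> = twist V2 (- V1)" by simp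
  finally show ?thesis by simp
qed

text \<open>Serves the degenerate case: a pair whose second field is zero can be exchanged for the
  zero pair, which is of type C11.\<close>

lemma twist_zero_right: "twist V 0 = twist 0 0"
proof -
  have 0: "uea_gen 0 = 0" using uea_gen_add[of 0 0] by simp
  have "a \<otimes> 0 = 0" "0 \<otimes> a = 0" for a
    using tensor_add_right[of a 0 0] tensor_add_left[of 0 0 a] by simp_all
  then show ?thesis by (simp add: twist_def 0)
qed

section \<open>The classification\<close>

lemma type_C21_iff: "type_C21 V1 V2 \<longleftrightarrow> (\<exists>g c s. smooth g \<and> s \<noteq> 0 \<and>
    V1 = similitude_field (\<lambda>_. 0) c 0 s \<and> V2 = similitude_field g 0 0 0)"
  by (simp add: type_C21_def similitude_field_def)

lemma type_C31_iff: "type_C31 V1 V2 \<longleftrightarrow> type_C21 V2 V1"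
  unfolding type_C31_def type_C21_def by blast

lemma type_C11_iff: "type_C11 V1 V2 \<longleftrightarrow> (\<exists>f g c1 c2. smooth f \<and> smooth g \<and> time_commute f g \<and>
    V1 = similitude_field f c1 0 0 \<and> V2 = similitude_field g c2 0 0)"
  by (simp add: type_C11_def similitude_field_def)

lemma trans_field_scaleR: "trans_field (r *\<^sub>R c) = r *\<^sub>R trans_field c"
  by (simp add: trans_field_def scaleR_sum_right)

lemma type_C12_iff: "type_C12 V1 V2 \<longleftrightarrow> (\<exists>f g c1 d \<kappa>. smooth f \<and> smooth g \<and> time_commute f g \<and>
    d \<noteq> 0 \<and> V1 = similitude_field f c1 d 0 \<and> V2 = similitude_field g (\<kappa> *\<^sub>R d) 0 0)"
  by (simp add: type_C12_def similitude_field_def trans_field_scaleR)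

lemma type_C22_iff: "type_C22 V1 V2 \<longleftrightarrow> (\<exists>g c d s. smooth g \<and> d \<noteq> 0 \<and> s \<noteq> 0 \<and>
    V1 = similitude_field (\<lambda>_. 0) c d s \<and> V2 = similitude_field g 0 0 0)"
  by (simp add: type_C22_def similitude_field_def)

lemma levi_civita_cross: "(\<Sum>j\<in>UNIV. \<Sum>k\<in>UNIV. d $ j * c $ k * levi_civita j k i) = (d \<times> c) $ i"
  using exhaust_3[of i] by (auto simp: sum_3 levi_civita_def cross3_simps)

lemma type_C32_iff: "type_C32 V1 V2 \<longleftrightarrow> (\<exists>f g d c s. smooth f \<and> smooth g \<and> time_commute f g \<and>
    d \<noteq> 0 \<and> s \<noteq> 0 \<and> V1 = similitude_field f ((1 / s) *\<^sub>R (d \<times> c)) d 0 \<and>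
    V2 = similitude_field g c 0 s)"
  by (simp add: type_C32_def similitude_field_def levi_civita_cross trans_field_scaleR
      trans_field_def[of "_ \<times> _", symmetric])

lemma residual_iff: "residual V1 V2 \<longleftrightarrow> (\<exists>f g c d s. smooth f \<and> smooth g \<and> time_commute f g \<and>
    \<not> lin_dep_on UNIV f g \<and> s \<noteq> 0 \<and> V1 = similitude_field f c d s \<and> V2 = similitude_field g 0 0 0)"
  by (simp add: residual_def similitude_field_def)

section \<open>The commutation equations\<close>

lemma bracket_similitude_eq_zero_iff:
  assumes f: "smooth f" and g: "smooth g"
  shows "bracket (similitude_field f c d s) (similitude_field g c' d' s') = 0 \<longleftrightarrow>
    time_commute f g \<and> d' \<times> c - d \<times> c' + s' *\<^sub>R c - s *\<^sub>R c' = 0 \<and> d' \<times> d = 0"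
    (is "_ \<longleftrightarrow> ?R")
proof
  assume "bracket (similitude_field f c d s) (similitude_field g c' d' s') = 0"
  from similitude_field_eq_zero[OF smooth_wronskian[OF f g] this[unfolded bracket_similitude[OF f g]]]
  show ?R by (simp add: time_commute_iff[OF f g])
next
  assume R: ?R
  then have "(\<lambda>t. f t * deriv g t - deriv f t * g t) = (\<lambda>_. 0)"
    by (simp add: time_commute_iff[OF f g])
  with R show "bracket (similitude_field f c d s) (similitude_field g c' d' s') = 0"
    by (simp add: bracket_similitude[OF f g] similitude_field_zero)
qed

lemma time_commute_zero:
  assumes "smooth f"
  shows "time_commute (\<lambda>_. 0) f" "time_commute f (\<lambda>_. 0)"
  by (simp_all add: time_commute_iff assms smooth_const)

text \<open>The Wronskian is bilinear and alternating, so adding a multiple of one function to the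
  other leaves it unchanged.\<close>

lemma time_commute_shear:
  assumes f: "smooth f" and g: "smooth g" and c: "time_commute f g"
  shows "time_commute f (\<lambda>t. g t + \<kappa> * f t)" "time_commute (\<lambda>t. f t + \<kappa> * g t) g"
proof -
  have D: "deriv (\<lambda>t. g t + \<kappa> * f t) t = deriv g t + \<kappa> * deriv f t"
    if "smooth f" "smooth g" for f g t
    by (rule DERIV_imp_deriv)
      (auto intro!: derivative_eq_intros smooth_has_real_derivative that)
  have s: "smooth (\<lambda>t. g t + \<kappa> * f t)" if "smooth f" "smooth g" for f g :: "real \<Rightarrow> real"
    by (intro smooth_add smooth_mult smooth_const that)
  show "time_commute f (\<lambda>t. g t + \<kappa> * f t)" "time_commute (\<lambda>t. f t + \<kappa> * g t) g"
    using c f g by (simp_all add: time_commute_iff s D algebra_simps)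
qed

lemma smooth_time_commute_rotate:
  assumes f: "smooth f" and g: "smooth g" and c: "time_commute f g"
  shows "smooth (\<lambda>t. - f t)" "time_commute g (\<lambda>t. - f t)"
proof -
  show s: "smooth (\<lambda>t. - f t)" using smooth_scaleR_const[OF f, of "- 1"] by simp
  have "deriv (\<lambda>t. - f t) t = - deriv f t" for t
    by (rule DERIV_imp_deriv) (rule DERIV_minus[OF smooth_has_real_derivative[OF f]])
  then show "time_commute g (\<lambda>t. - f t)"
    using c by (simp add: time_commute_iff f g s mult.commute)
qed

text \<open>All types consist of similitude fields, so the three commutation equations are what has
  to be checked. In C12 the second translation is parallel to the rotation axis; in C32 the first
  translation is the solution of \<open>s2 *\<^sub>R c1 = d1 \<times> c2\<close>.\<close>

lemma listed_or_residual_commutes: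
  assumes "listed V1 V2 \<or> residual V1 V2"
  shows "bracket V1 V2 = 0 \<and> preserves_e3 V1 \<and> preserves_e3 V2"
proof -
  have "\<exists>f g c1 c2 d1 d2 s1 s2. smooth f \<and> smooth g \<and> time_commute f g \<and>
      d2 \<times> c1 - d1 \<times> c2 + s2 *\<^sub>R c1 - s1 *\<^sub>R c2 = 0 \<and> d2 \<times> d1 = 0 \<and>
      V1 = similitude_field f c1 d1 s1 \<and> V2 = similitude_field g c2 d2 s2" (is "?E V1 V2")
    using assms[unfolded listed_def]
  proof (elim disjE)
    assume "type_C11 V1 V2"
    then obtain f g c1 c2 where h: "smooth f" "smooth g" "time_commute f g"
      "V1 = similitude_field f c1 0 0" "V2 = similitude_field g c2 0 0"
      unfolding type_C11_iff by blast
    show ?thesis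
      by (rule exI[of _ f], rule exI[of _ g], rule exI[of _ c1], rule exI[of _ c2],
          rule exI[of _ 0], rule exI[of _ 0], rule exI[of _ 0], rule exI[of _ 0]) (simp add: h)
  next
    assume "type_C21 V1 V2"
    then obtain g c s where h: "smooth g"
      "V1 = similitude_field (\<lambda>_. 0) c 0 s" "V2 = similitude_field g 0 0 0"
      unfolding type_C21_iff by blast
    show ?thesis
      by (rule exI[of _ "\<lambda>_. 0"], rule exI[of _ g], rule exI[of _ c], rule exI[of _ 0],
          rule exI[of _ 0], rule exI[of _ 0], rule exI[of _ s], rule exI[of _ 0])
        (simp add: h smooth_const time_commute_zero)
  next
    assume "type_C31 V1 V2"
    then obtain g c s where h: "smooth g"
      "V2 = similitude_field (\<lambda>_. 0) c 0 s" "V1 = similitude_field g 0 0 0"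
      unfolding type_C31_iff type_C21_iff by blast
    show ?thesis
      by (rule exI[of _ g], rule exI[of _ "\<lambda>_. 0"], rule exI[of _ 0], rule exI[of _ c],
          rule exI[of _ 0], rule exI[of _ 0], rule exI[of _ 0], rule exI[of _ s])
        (simp add: h smooth_const time_commute_zero)
  next
    assume "type_C12 V1 V2"
    then obtain f g c1 d \<kappa> where h: "smooth f" "smooth g" "time_commute f g"
      "V1 = similitude_field f c1 d 0" "V2 = similitude_field g (\<kappa> *\<^sub>R d) 0 0"
      unfolding type_C12_iff by blast
    show ?thesis
      by (rule exI[of _ f], rule exI[of _ g], rule exI[of _ c1], rule exI[of _ "\<kappa> *\<^sub>R d"],
          rule exI[of _ d], rule exI[of _ 0], rule exI[of _ 0], rule exI[of _ 0])
        (simp add: h cross_mult_right)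
  next
    assume "type_C22 V1 V2"
    then obtain g c d s where h: "smooth g"
      "V1 = similitude_field (\<lambda>_. 0) c d s" "V2 = similitude_field g 0 0 0"
      unfolding type_C22_iff by blast
    show ?thesis
      by (rule exI[of _ "\<lambda>_. 0"], rule exI[of _ g], rule exI[of _ c], rule exI[of _ 0],
          rule exI[of _ d], rule exI[of _ 0], rule exI[of _ s], rule exI[of _ 0])
        (simp add: h smooth_const time_commute_zero)
  next
    assume "type_C32 V1 V2"
    then obtain f g d c s where h: "smooth f" "smooth g" "time_commute f g" "s \<noteq> 0"
      "V1 = similitude_field f ((1 / s) *\<^sub>R (d \<times> c)) d 0" "V2 = similitude_field g c 0 s"
      unfolding type_C32_iff by blast
    show ?thesis
      by (rule exI[of _ f], rule exI[of _ g], rule exI[of _ "(1 / s) *\<^sub>R (d \<times> c)"],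
          rule exI[of _ c], rule exI[of _ d], rule exI[of _ 0], rule exI[of _ 0], rule exI[of _ s])
        (simp add: h)
  next
    assume "residual V1 V2"
    then obtain f g c d s where h: "smooth f" "smooth g" "time_commute f g"
      "V1 = similitude_field f c d s" "V2 = similitude_field g 0 0 0"
      unfolding residual_iff by blast
    show ?thesis
      by (rule exI[of _ f], rule exI[of _ g], rule exI[of _ c], rule exI[of _ 0],
          rule exI[of _ d], rule exI[of _ 0], rule exI[of _ s], rule exI[of _ 0]) (simp add: h)
  qed
  then obtain f g c1 c2 d1 d2 s1 s2 where h: "smooth f" "smooth g" "time_commute f g"
      "d2 \<times> c1 - d1 \<times> c2 + s2 *\<^sub>R c1 - s1 *\<^sub>R c2 = 0" "d2 \<times> d1 = 0"
      "V1 = similitude_field f c1 d1 s1" "V2 = similitude_field g c2 d2 s2"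
    by blast
  then show ?thesis by (simp add: bracket_similitude_eq_zero_iff preserves_e3_similitude)
qed

section \<open>Invariance of the classification under shears\<close>

lemma lin_dep_on_shear:
  assumes "lin_dep_on S f g"
  shows "lin_dep_on S f (\<lambda>x. g x + \<kappa> * f x)" "lin_dep_on S (\<lambda>x. f x + \<kappa> * g x) g"
proof -
  obtain a b where ab: "a \<noteq> 0 \<or> b \<noteq> 0" "\<And>x. x \<in> S \<Longrightarrow> a * f x + b * g x = 0"
    using assms unfolding lin_dep_on_def by blast
  \<comment> \<open>The coefficients transform contragrediently:
    \<open>a f + b g = (a - b \<kappa>) f + b (g + \<kappa> f)\<close>.\<close>
  show "lin_dep_on S f (\<lambda>x. g x + \<kappa> * f x)"
    unfolding lin_dep_on_def using ab
    by (intro exI[of _ "a - b * \<kappa>"] exI[of _ b]) (auto simp: algebra_simps)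
  show "lin_dep_on S (\<lambda>x. f x + \<kappa> * g x) g"
    unfolding lin_dep_on_def using ab
    by (intro exI[of _ a] exI[of _ "b - a * \<kappa>"]) (auto simp: algebra_simps)
qed

lemma lin_dep_on_rotate: "lin_dep_on S f g \<Longrightarrow> lin_dep_on S g (\<lambda>x. - f x)"
  unfolding lin_dep_on_def by (elim exE, rule_tac x = b in exI, rule_tac x = "- a" in exI) (auto simp: add.commute)

text \<open>Linear dependence of the time components is invariant under shears, so this predicate can be
  proved for any pair in the shear orbit.\<close>

definition classified :: "vfield \<Rightarrow> vfield \<Rightarrow> bool" where
  "classified V1 V2 \<longleftrightarrow> (\<exists>W1 W2. twist W1 W2 = twist V1 V2 \<and>
     (listed W1 W2 \<or> residual W1 W2 \<and> \<not> lin_dep_on UNIV (time_comp V1) (time_comp V2)))"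

lemma time_comp_minus: "time_comp (- V) = (\<lambda>p. - time_comp V p)"
  by (simp add: fun_eq_iff time_comp_def uminus_vfield.rep_eq)

lemma time_comp_shear: "time_comp (V - \<kappa> *\<^sub>R W) = (\<lambda>p. time_comp V p + (- \<kappa>) * time_comp W p)"
  by (simp add: fun_eq_iff time_comp_def minus_vfield.rep_eq scaleR_vfield.rep_eq)

text \<open>The sheared pair has the same twist, and independence of its time components passes to
  the original pair by the contrapositive of \<open>lin_dep_on_shear\<close>.\<close>

lemma classified_shear_right: "classified V1 (V2 - \<kappa> *\<^sub>R V1) \<Longrightarrow> classified V1 V2"
  unfolding classified_def twist_shear time_comp_shear using lin_dep_on_shear(1) by blast

lemma classified_shear_left: "classified (V1 - \<kappa> *\<^sub>R V2) V2 \<Longrightarrow> classified V1 V2"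
  unfolding classified_def twist_shear_left time_comp_shear using lin_dep_on_shear(2) by blast

lemma classified_rotate: "classified V2 (- V1) \<Longrightarrow> classified V1 V2"
  unfolding classified_def twist_rotate time_comp_minus using lin_dep_on_rotate by blast

lemma listed_imp_classified: "listed V1 V2 \<Longrightarrow> classified V1 V2"
  unfolding classified_def by blast

lemma time_comp_similitude: "smooth f \<Longrightarrow> time_comp (similitude_field f c d s) = (\<lambda>p. f (fst p))"
  by (simp add: fun_eq_iff time_comp_def vf_at_similitude)

lemma similitude_shear:
  assumes "smooth f" "smooth g"
  shows "similitude_field f c d s - \<kappa> *\<^sub>R similitude_field g c' d' s' =
    similitude_field (\<lambda>t. f t + (- \<kappa>) * g t) (c - \<kappa> *\<^sub>R c') (d - \<kappa> *\<^sub>R d') (s - \<kappa> * s')"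
  using similitude_lin_comb[OF assms, of 1 c d s "- \<kappa>" c' d' s'] by simp

lemma similitude_uminus:
  assumes "smooth f"
  shows "- similitude_field f c d s = similitude_field (\<lambda>t. - f t) (- c) (- d) (- s)"
  using similitude_lin_comb[OF assms assms, of "- 1" c d s 0 0 0 0] by simp

lemma smooth_shear:
  fixes f g :: "real \<Rightarrow> real"
  shows "smooth f \<Longrightarrow> smooth g \<Longrightarrow> smooth (\<lambda>t. f t + \<kappa> * g t)"
  by (intro smooth_add smooth_mult smooth_const)

section \<open>Reduction to normal forms\<close>

lemma listed_dilation_time:
  assumes "smooth g" "s \<noteq> 0"
  shows "listed (similitude_field (\<lambda>_. 0) c d s) (similitude_field g 0 0 0)"
proof (cases "d = 0")
  case True
  then have "type_C21 (similitude_field (\<lambda>_. 0) c d s) (similitude_field g 0 0 0)"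
    unfolding type_C21_iff using assms by metis
  then show ?thesis by (simp add: listed_def)
next
  case False
  then have "type_C22 (similitude_field (\<lambda>_. 0) c d s) (similitude_field g 0 0 0)"
    unfolding type_C22_iff using assms by metis
  then show ?thesis by (simp add: listed_def)
qed

text \<open>Subtracting multiples of the second field changes only the time component
  \<open>f\<close> of the first. This removes \<open>f\<close> if it is a multiple of
  \<open>g\<close>; if no linear relation exists, the pair is residual.\<close>

lemma classified_dilation_time:
  assumes f: "smooth f" and g: "smooth g" and fg: "time_commute f g" and s: "s \<noteq> 0"
  shows "classified (similitude_field f c d s) (similitude_field g 0 0 0)"
proof (cases "lin_dep_on UNIV f g")
  case True
  then obtain a b where ab: "a \<noteq> 0 \<or> b \<noteq> 0" "\<And>t. a * f t + b * g t = 0"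
    unfolding lin_dep_on_def by blast
  show ?thesis
  proof (cases "a = 0")
    case True
    \<comment> \<open>The relation reduces to \<open>b * g t = 0\<close> with \<open>b\<close>
      nonzero, so the second field is zero and the twist is that of the zero pair.\<close>
    then have "g = (\<lambda>_. 0)" using ab by auto
    then have "similitude_field g 0 0 0 = 0" by (simp add: similitude_field_zero)
    moreover have "listed 0 0"
      unfolding listed_def type_C11_iff
      using similitude_field_zero smooth_const time_commute_zero[OF smooth_const] by metis
    ultimately show ?thesis unfolding classified_def using twist_zero_right by metis
  next
    case False
    \<comment> \<open>The relation says that \<open>f\<close> is \<open>-(b / a)\<close> times
      \<open>g\<close>, so this shear removes the time component.\<close>
    let ?W = "similitude_field f c d s - (- (b / a)) *\<^sub>R similitude_field g 0 0 0"
    have "f t + - (- (b / a)) * g t = 0" for t using ab(2)[of t] False by (simp add: field_simps)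
    then have W: "?W = similitude_field (\<lambda>_. 0) c d s"
      unfolding similitude_shear[OF f g] by simp
    have "classified ?W (similitude_field g 0 0 0)"
      unfolding W by (rule listed_imp_classified[OF listed_dilation_time[OF g s]])
    then show ?thesis by (rule classified_shear_left)
  qed
next
  case False
  then have "\<not> lin_dep_on UNIV (time_comp (similitude_field f c d s)) (time_comp (similitude_field g 0 0 0))"
    by (auto simp: time_comp_similitude f g lin_dep_on_def)
  moreover have "residual (similitude_field f c d s) (similitude_field g 0 0 0)"
    unfolding residual_iff using f g fg s False by blast
  ultimately show ?thesis unfolding classified_def by blast
qed

lemma cross_eq_0_imp_parallel:
  fixes x y :: "real ^ 3"
  assumes "x \<times> y = 0" "x \<noteq> 0"
  shows "\<exists>\<kappa>. y = \<kappa> *\<^sub>R x"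
  using assms by (auto simp: cross_eq_0 collinear_lemma intro: exI[of _ 0])

text \<open>If \<open>s2 = 0\<close>, the commutation equation restricts \<open>c2\<close>: it is
  parallel to \<open>d\<close> or, when \<open>s1\<close> is nonzero, zero. If \<open>s2\<close> is
  nonzero, a shear removes the dilation \<open>s1\<close> of the first field.\<close>

lemma classified_no_rotation:
  assumes f: "smooth f" and g: "smooth g" and fg: "time_commute f g"
    and eq: "s2 *\<^sub>R c1 - d \<times> c2 - s1 *\<^sub>R c2 = 0"
  shows "classified (similitude_field f c1 d s1) (similitude_field g c2 0 s2)"
proof (cases "s2 = 0")
  case 0: True
  show ?thesis
  proof (cases "s1 = 0")
    case True
    then have "d \<times> c2 = 0" using eq 0 by simp
    \<comment> \<open>For \<open>d = 0\<close> this is C11; otherwise \<open>c2\<close> is a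
      multiple of \<open>d\<close>, which is C12.\<close>
    then have "listed (similitude_field f c1 d s1) (similitude_field g c2 0 s2)"
      using cross_eq_0_imp_parallel[of d c2] f g fg 0 True
      unfolding listed_def type_C11_iff type_C12_iff by metis
    then show ?thesis by (rule listed_imp_classified)
  next
    case False
    have "d \<times> c2 + s1 *\<^sub>R c2 = 0" using eq 0 by (simp add: algebra_simps) (metis add.inverse_inverse add_eq_0_iff)
    \<comment> \<open>Pairing with \<open>c2\<close> annihilates \<open>d \<times> c2\<close> and
      leaves \<open>s1\<close> times the squared norm of \<open>c2\<close>.\<close>
    then have "c2 \<bullet> (d \<times> c2 + s1 *\<^sub>R c2) = 0" by simp
    then have "c2 = 0" using False by (simp add: inner_add_right dot_cross_self)
    then show ?thesis using classified_dilation_time[OF f g fg False] 0 by simp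
  qed
next
  case False
  let ?\<kappa> = "s1 / s2" and ?V = "similitude_field f c1 d s1" and ?W = "similitude_field g c2 0 s2"
  let ?h = "\<lambda>t. f t + (- ?\<kappa>) * g t"
  have h: "smooth ?h" "time_commute ?h g"
    using smooth_shear[OF f g] time_commute_shear(2)[OF f g fg] by blast+
  \<comment> \<open>The commutation equation fixes the translation left after the shear: it is the
    one prescribed in C32.\<close>
  have "c1 - ?\<kappa> *\<^sub>R c2 = (1 / s2) *\<^sub>R (d \<times> c2)"
  proof -
    have "s2 *\<^sub>R (c1 - ?\<kappa> *\<^sub>R c2) = d \<times> c2" using eq False by (simp add: algebra_simps)
    then have "(1 / s2) *\<^sub>R (s2 *\<^sub>R (c1 - ?\<kappa> *\<^sub>R c2)) = (1 / s2) *\<^sub>R (d \<times> c2)" by simp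
    then show ?thesis using False by simp
  qed
  then have V: "?V - ?\<kappa> *\<^sub>R ?W = similitude_field ?h ((1 / s2) *\<^sub>R (d \<times> c2)) d 0"
    unfolding similitude_shear[OF f g] using False by simp
  have "classified (?V - ?\<kappa> *\<^sub>R ?W) ?W"
  proof (cases "d = 0")
    case True
    \<comment> \<open>Without rotation the sheared field is purely temporal; the quarter turn puts
      the dilating field first, as in \<open>classified_dilation_time\<close>.\<close>
    have "- (?V - ?\<kappa> *\<^sub>R ?W) = similitude_field (\<lambda>t. - ?h t) 0 0 0"
      unfolding V by (subst similitude_uminus[OF h(1)]) (simp add: True)
    then have "classified ?W (- (?V - ?\<kappa> *\<^sub>R ?W))"
      using classified_dilation_time[OF g smooth_time_commute_rotate[OF h(1) g h(2)] False, of c2 0]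
      by (simp only:)
    then show ?thesis by (rule classified_rotate)
  next
    case d: False
    have "listed (?V - ?\<kappa> *\<^sub>R ?W) ?W"
      unfolding V listed_def type_C32_iff using h g d False by blast
    then show ?thesis by (rule listed_imp_classified)
  qed
  then show ?thesis by (rule classified_shear_left)
qed

text \<open>One of the two rotations is brought to zero. If \<open>d1 = 0\<close>, a quarter turn
  exchanges the fields; otherwise \<open>d2 \<times> d1 = 0\<close> makes \<open>d2\<close> a
  multiple of \<open>d1\<close>, and a shear removes it.\<close>

theorem commuting_pair_classified:
  assumes br: "bracket V1 V2 = 0" and V1: "preserves_e3 V1" and V2: "preserves_e3 V2"
  shows "classified V1 V2"
proof -
  obtain f c1 d1 s1 where f: "smooth f" and eq1: "V1 = similitude_field f c1 d1 s1"
    using preserves_e3_imp_similitude[OF V1] by blast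
  obtain g c2 d2 s2 where g: "smooth g" and eq2: "V2 = similitude_field g c2 d2 s2"
    using preserves_e3_imp_similitude[OF V2] by blast
  have fg: "time_commute f g" and c: "d2 \<times> c1 - d1 \<times> c2 + s2 *\<^sub>R c1 - s1 *\<^sub>R c2 = 0"
    and d: "d2 \<times> d1 = 0"
    using br unfolding eq1 eq2 bracket_similitude_eq_zero_iff[OF f g] by blast+
  show ?thesis
  proof (cases "d1 = 0")
    case True
    have "(- s1) *\<^sub>R c2 - d2 \<times> (- c1) - s2 *\<^sub>R (- c1) = 0"
      using c True by (simp add: algebra_simps)
    note classified_no_rotation[OF g smooth_time_commute_rotate[OF f g fg] this]
    moreover have "- V1 = similitude_field (\<lambda>t. - f t) (- c1) 0 (- s1)"
      unfolding eq1 similitude_uminus[OF f] by (simp add: True)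
    ultimately have "classified V2 (- V1)" unfolding eq2 by (simp only:)
    then show ?thesis by (rule classified_rotate)
  next
    case False
    then obtain \<kappa> where k: "d2 = \<kappa> *\<^sub>R d1"
      using cross_eq_0_imp_parallel[of d1 d2] d cross_skew[of d1 d2] by auto
    \<comment> \<open>This is the commutation equation for the sheared pair: the terms in
      \<open>\<kappa> * s1\<close> cancel, and \<open>\<kappa>\<close> times
      \<open>d1 \<times> c1\<close> is \<open>d2 \<times> c1\<close>.\<close>
    have "(s2 - \<kappa> * s1) *\<^sub>R c1 - d1 \<times> (c2 - \<kappa> *\<^sub>R c1) - s1 *\<^sub>R (c2 - \<kappa> *\<^sub>R c1) = 0"
      using c unfolding k by (simp add: algebra_simps cross_mult_left cross_mult_right Cross3.right_diff_distrib)
    note classified_no_rotation[OF f smooth_shear[OF g f] time_commute_shear(1)[OF f g fg] this]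
    moreover have "V2 - \<kappa> *\<^sub>R V1 =
        similitude_field (\<lambda>t. g t + (- \<kappa>) * f t) (c2 - \<kappa> *\<^sub>R c1) 0 (s2 - \<kappa> * s1)"
      unfolding eq1 eq2 similitude_shear[OF g f] k by simp
    ultimately have "classified V1 (V2 - \<kappa> *\<^sub>R V1)" unfolding eq1 by (simp only:)
    then show ?thesis by (rule classified_shear_right)
  qed
qed

text \<open>Smooth time components can commute without being proportional, as the last clause shows.
  The six types are therefore asserted for linearly dependent time components, and in general
  together with the residual class, no member of which shares its twist with a listed pair. Local
  dependence refers to intervals because the constants may differ between components of the overlap
  of the supports.\<close>

theorem mainTheorem7:
  shows
    "(\<forall>V1 V2. bracket V1 V2 = 0 \<and> preserves_e3 V1 \<and> preserves_e3 V2 \<longrightarrow>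
        (lin_dep_on UNIV (time_comp V1) (time_comp V2) \<longrightarrow>
           (\<exists>W1 W2. twist W1 W2 = twist V1 V2 \<and> listed W1 W2)) \<and>
        (\<exists>W1 W2. twist W1 W2 = twist V1 V2 \<and> (listed W1 W2 \<or> residual W1 W2)))
     \<and> (\<forall>V1 V2 W1 W2. residual V1 V2 \<and> twist W1 W2 = twist V1 V2 \<longrightarrow> \<not> listed W1 W2)
     \<and> (\<forall>V1 V2. type_C31 V1 V2 \<longleftrightarrow> type_C21 V2 V1)
     \<and> (\<forall>V1 V2. listed V1 V2 \<or> residual V1 V2 \<longrightarrow>
          bracket V1 V2 = 0 \<and> preserves_e3 V1 \<and> preserves_e3 V2)
     \<and> (\<forall>f g :: real \<Rightarrow> real. smooth f \<and> smooth g \<longrightarrow>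
          ((\<forall>t. f t = 0) \<or> (\<forall>t. g t = 0) \<longrightarrow> time_commute f g) \<and>
          (time_commute f g \<and> (\<exists>t. f t \<noteq> 0) \<and> (\<exists>t. g t \<noteq> 0) \<and> real_analytic f \<and> real_analytic g \<longrightarrow>
             (\<exists>\<kappa>. \<forall>t. g t = \<kappa> * f t)) \<and>
          (time_commute f g \<longleftrightarrow>
             (\<forall>I. is_interval I \<and> I \<subseteq> support_on UNIV f \<inter> support_on UNIV g \<longrightarrow> lin_dep_on I f g)) \<and>
          (support_on UNIV f \<inter> support_on UNIV g = {} \<longrightarrow> time_commute f g))
     \<and> (\<exists>f g :: real \<Rightarrow> real. smooth f \<and> smooth g \<and> time_commute f g \<and>
          support_on UNIV f \<inter> support_on UNIV g = {} \<and> \<not> lin_dep_on UNIV f g)"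
proof (intro conjI allI impI)
  fix V1 V2
  assume V: "bracket V1 V2 = 0 \<and> preserves_e3 V1 \<and> preserves_e3 V2"
  then have cl: "classified V1 V2" using commuting_pair_classified by blast
  show "\<exists>W1 W2. twist W1 W2 = twist V1 V2 \<and> listed W1 W2"
    if "lin_dep_on UNIV (time_comp V1) (time_comp V2)"
    using cl that unfolding classified_def by blast
  show "\<exists>W1 W2. twist W1 W2 = twist V1 V2 \<and> (listed W1 W2 \<or> residual W1 W2)"
    using cl unfolding classified_def by blast
next
  fix V1 V2 W1 W2
  assume "residual V1 V2 \<and> twist W1 W2 = twist V1 V2"
  then show "\<not> listed W1 W2" using residual_not_listed by metis
next
  fix V1 V2
  show "type_C31 V1 V2 \<longleftrightarrow> type_C21 V2 V1" by (rule type_C31_iff)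
next
  fix V1 V2
  assume "listed V1 V2 \<or> residual V1 V2"
  from listed_or_residual_commutes[OF this]
  show "bracket V1 V2 = 0" "preserves_e3 V1" "preserves_e3 V2" by blast+
next
  fix f g :: "real \<Rightarrow> real"
  assume "smooth f \<and> smooth g"
  then have f: "smooth f" and g: "smooth g" by blast+
  note W = time_commute_iff[OF f g]
  show "time_commute f g" if "(\<forall>t. f t = 0) \<or> (\<forall>t. g t = 0)"
  proof -
    have "f = (\<lambda>_. 0) \<or> g = (\<lambda>_. 0)" using that by blast
    then show ?thesis using time_commute_zero f g by blast
  qed
  show "\<exists>\<kappa>. \<forall>t. g t = \<kappa> * f t"
    if "time_commute f g \<and> (\<exists>t. f t \<noteq> 0) \<and> (\<exists>t. g t \<noteq> 0) \<and> real_analytic f \<and> real_analytic g"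
    using that real_analytic_proportional[OF f _ g] W by blast
  show iff: "time_commute f g \<longleftrightarrow>
      (\<forall>I. is_interval I \<and> I \<subseteq> support_on UNIV f \<inter> support_on UNIV g \<longrightarrow> lin_dep_on I f g)"
    unfolding W by (rule wronskian_zero_iff_local_dependence[OF f g])
  show "time_commute f g" if "support_on UNIV f \<inter> support_on UNIV g = {}"
    \<comment> \<open>The only interval inside the empty overlap is empty, and on it dependence is
      trivial.\<close>
    unfolding iff that by (auto simp: lin_dep_on_def)
next
  obtain f g :: "real \<Rightarrow> real" where fg: "smooth f" "smooth g"
    "support_on UNIV f \<inter> support_on UNIV g = {}" "\<not> lin_dep_on UNIV f g"
    using ex_smooth_disjoint_supports by blast
  have "time_commute f g"
    unfolding time_commute_iff[OF fg(1,2)] wronskian_zero_iff_local_dependence[OF fg(1,2)] fg(3)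
    by (auto simp: lin_dep_on_def)
  with fg show "\<exists>f g :: real \<Rightarrow> real. smooth f \<and> smooth g \<and> time_commute f g \<and>
      support_on UNIV f \<inter> support_on UNIV g = {} \<and> \<not> lin_dep_on UNIV f g"
    by blast
qed

end
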